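(* Let $0<b\le+\infty$, and let $W,R:[0,b)\to[0,\infty)$ be left-continuous, nondecreasing, unbounded functions with $W(0)=R(0)=0$ having no discontinuities in common. Let $m$ be the Neumann $m$-function of the system $$u_1(x)=u_1(0)+\int_{[0,x)}u_2(t)\,dR(t),\qquad u_2(x)=u_2(0)-\lambda\int_{[0,x)}u_1(t)\,dW(t),\qquad x\in[0,b).$$ Then $$\sup_{y\in(0,1)}\frac{\mathrm{Im}\, m(\mathrm{i}y)}{\mathrm{Re}\, m(\mathrm{i}y)}<+\infty$$ if and only if the function $W\circ R^{-1}$ is positively increasing at $\infty$.
   Context: Integrals are Lebesgue--Stieltjes integrals. For $\lambda\in\mathbb{C}\setminus\mathbb{R}$ let $(c,c^{[1]})^T$ and $(s,s^{[1]})^T$ be the solutions $(u_1,u_2)^T$ of the system with initial values $(1,0)^T$ and $(0,1)^T$ at $x=0$, respectively. Since $W$ and $R$ are unbounded, the system is in the limit point case at $b$, and the Neumann $m$-function is defined by the requirement that $m(\lambda)$ is the unique complex number with $\psi(\cdot,\lambda)=s(\cdot,\lambda)-m(\lambda)c(\cdot,\lambda)\in L^2((0,b);dW)$. The generalized inverse of a nondecreasing left-continuous function $f:(0,b)\to[0,\infty)$ is $f^{-1}(x)=\inf\{y: f(y)\ge x\}$. A nondecreasing function $f$ is called positively increasing at $\infty$ if there is $t\in(0,1)$ with $\limsup_{x\to\infty}f(xt)/f(x)\neq1$. *)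

theory Defs
  imports "HOL-Analysis.Analysis"
begin

definition half_open :: "ereal \<Rightarrow> real set" where
  "half_open b = {x. 0 \<le> x \<and> ereal x < b}"

text \<open>
  The library's \<open>interval_measure\<close> is for right-continuous functions on the whole line and
  measures intervals \<open>(x, y]\<close>.  For a left-continuous \<open>F\<close> on \<open>[0, b)\<close>, the Lebesgue--Stieltjes
  measure \<open>dF\<close> is the Borel measure on \<open>[0, b)\<close> with mass \<open>F y - F x\<close> on \<open>[x, y)\<close>;
  in particular \<open>dF\<close> has an atom of mass \<open>F (0+) - F 0\<close> at \<open>0\<close>.
\<close>

definition stieltjes_measure :: "ereal \<Rightarrow> (real \<Rightarrow> real) \<Rightarrow> real measure" where
  "stieltjes_measure b F =
     extend_measure (half_open b) {(x, y). 0 \<le> x \<and> x \<le> y \<and> ereal y < b}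
       (\<lambda>(x, y). {x..<y}) (\<lambda>(x, y). ennreal (F y - F x))"

lemma half_open_subset_Pow:
  "(\<lambda>(x, y). {x..<y}) ` {(x::real, y). 0 \<le> x \<and> x \<le> y \<and> ereal y < b} \<subseteq> Pow (half_open b)"
proof -
  have "ereal z < b" if "z < y" "ereal y < b" for z y
    using that by (meson less_ereal.simps(1) less_trans)
  then show ?thesis by (auto simp: half_open_def)
qed

lemma space_stieltjes_measure [simp]: "space (stieltjes_measure b F) = half_open b"
  unfolding stieltjes_measure_def by (rule space_extend_measure[OF half_open_subset_Pow])

text \<open>
  Under the hypotheses placed on \<open>W\<close> and \<open>R\<close> such a measure exists (it is the image of Lebesgue
  measure on \<open>[0, \<infinity>)\<close> under a generalized inverse of \<open>F\<close>), so \<^const>\<open>extend_measure\<close> does not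
  fall back to its default value.
\<close>

lemma emeasure_stieltjes_measure:
  assumes mono: "mono_on (half_open b) F"
    and left: "\<And>x. 0 < x \<Longrightarrow> ereal x < b \<Longrightarrow> continuous (at_left x) F"
    and F0: "F 0 = 0"
    and unbdd: "\<not> bdd_above (F ` half_open b)"
    and xy: "0 \<le> x" "x \<le> y" "ereal y < b"
  shows "emeasure (stieltjes_measure b F) {x..<y} = ennreal (F y - F x)"
proof -
  let ?D = "half_open b"
  let ?I = "{(x::real, y). 0 \<le> x \<and> x \<le> y \<and> ereal y < b}"
  define g where "g s = Sup {t \<in> ?D. F t \<le> s}" for s
  define L where "L = restrict_space lborel {0::real..}"
  let ?N = "stieltjes_measure b F"
  have D: "z \<in> ?D" if "0 \<le> z" "z \<le> w" "ereal w < b" for z w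
    using that unfolding half_open_def by (auto intro: le_less_trans[of "ereal z" "ereal w"])
  have D0: "0 \<in> ?D" using D[of 0 y] xy by auto
  have upper: "\<exists>T\<in>?D. s < F T \<and> (\<forall>t\<in>?D. F t \<le> s \<longrightarrow> t < T)" for s
  proof -
    obtain T where T: "T \<in> ?D" "s < F T"
      using unbdd unfolding bdd_above_def by (metis imageE not_le)
    moreover have "t < T" if "t \<in> ?D" "F t \<le> s" for t
      using mono_onD[OF mono T(1) that(1)] T that by linarith
    ultimately show ?thesis by blast
  qed
  have bdd: "bdd_above {t \<in> ?D. F t \<le> s}" for s
    using upper[of s] unfolding bdd_above_def by (force intro: less_imp_le)
  have ne: "{t \<in> ?D. F t \<le> s} \<noteq> {}" if "0 \<le> s" for s
    using that D0 F0 by auto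
  have gD: "g s \<in> ?D" if s: "0 \<le> s" for s
  proof -
    from upper[of s] obtain T where T: "T \<in> ?D" "\<And>t. t \<in> ?D \<Longrightarrow> F t \<le> s \<Longrightarrow> t < T" by auto
    have "g s \<le> T" unfolding g_def by (rule cSup_least[OF ne[OF s]]) (auto dest: T(2))
    moreover have "0 \<le> g s" unfolding g_def
      by (rule cSup_upper[OF _ bdd]) (use D0 F0 s in auto)
    ultimately show ?thesis using D T(1) by (auto simp: half_open_def)
  qed
  have galois: "z \<le> g s \<longleftrightarrow> F z \<le> s" if s: "0 \<le> s" and z: "z \<in> ?D" for s z
  proof
    assume "F z \<le> s" then show "z \<le> g s" unfolding g_def
      by (intro cSup_upper[OF _ bdd]) (use z in auto)
  next
    assume le: "z \<le> g s"
    show "F z \<le> s"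
    proof (cases "z = 0")
      case True then show ?thesis using F0 s by simp
    next
      case False
      then have zpos: "0 < z" "ereal z < b" using z by (auto simp: half_open_def)
      have below: "F w \<le> s" if w: "0 < w" "w < z" for w
      proof -
        have "w < Sup {t \<in> ?D. F t \<le> s}" using w le by (simp add: g_def)
        then obtain t where t: "t \<in> ?D" "F t \<le> s" "w < t"
          using less_cSup_iff[OF ne[OF s] bdd] by auto
        have "w \<in> ?D" using D[of w z] w zpos by auto
        then show ?thesis using mono_onD[OF mono _ t(1), of w] t by auto
      qed
      have "(F \<longlongrightarrow> F z) (at_left z)"
        using left[OF zpos] by (simp add: continuous_within)
      moreover have "eventually (\<lambda>w. F w \<le> s) (at_left z)"
        using eventually_at_left_real[OF zpos(1)] by eventually_elim (use below in auto)
      ultimately show ?thesis by (rule tendsto_upperbound) simp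
    qed
  qed
  have pre: "g -` {x..<y} \<inter> space L = {F x..<F y}" if "(x, y) \<in> ?I" for x y
  proof -
    have xD: "x \<in> ?D" and yD: "y \<in> ?D" using that D[of x y] D[of y y] by auto
    have "0 \<le> F x" using mono_onD[OF mono D0 xD] xD F0 by (auto simp: half_open_def)
    then show ?thesis
      using galois[OF _ xD] galois[OF _ yD]
      by (auto simp: L_def space_restrict_space not_le[symmetric])
  qed
  have sets_N: "sets ?N = sigma_sets ?D ((\<lambda>(x, y). {x..<y}) ` ?I)"
    unfolding stieltjes_measure_def by (rule sets_extend_measure[OF half_open_subset_Pow])
  have meas: "g \<in> measurable L ?N"
  proof (rule measurable_sigma_sets[OF sets_N half_open_subset_Pow])
    show "g \<in> space L \<rightarrow> ?D" using gD by (auto simp: L_def space_restrict_space)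
    fix A assume "A \<in> (\<lambda>(x, y). {x..<y}) ` ?I"
    then obtain x y where A: "A = {x..<y}" "(x, y) \<in> ?I" by auto
    have "{F x..<F y} \<subseteq> {0..}" using pre[OF A(2)] by (auto simp: L_def space_restrict_space)
    then show "g -` A \<inter> space L \<in> sets L"
      unfolding A(1) pre[OF A(2)] by (auto simp: L_def sets_restrict_space_iff)
  qed
  have val: "emeasure (distr L ?N g) {x..<y} = ennreal (F y - F x)" if i: "(x, y) \<in> ?I" for x y
  proof -
    have "{x..<y} \<in> sets ?N" unfolding sets_N using i by (intro sigma_sets.Basic) auto
    then have "emeasure (distr L ?N g) {x..<y} = emeasure L {F x..<F y}"
      using pre[OF i] by (simp add: emeasure_distr[OF meas])
    also have "\<dots> = emeasure lborel {F x..<F y}"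
      using pre[OF i] by (auto simp: L_def space_restrict_space intro!: emeasure_restrict_space)
    also have "\<dots> = ennreal (F y - F x)"
      using mono_onD[OF mono D[of x y] D[of y y]] i by simp
    finally show ?thesis .
  qed
  show ?thesis
  proof (rule emeasure_extend_measure_Pair[OF stieltjes_measure_def])
    show "emeasure (distr L ?N g) {i..<j} = ennreal (F j - F i)"
      if "0 \<le> i \<and> i \<le> j \<and> ereal j < b" for i j using val that by simp
    show "{i..<j} \<in> Pow ?D" if "0 \<le> i \<and> i \<le> j \<and> ereal j < b" for i j
      using half_open_subset_Pow[of b] that by blast
    show "positive (sets ?N) (emeasure (distr L ?N g))"
      using emeasure_positive[of "distr L ?N g"] by simp
    show "countably_additive (sets ?N) (emeasure (distr L ?N g))"
      using emeasure_countably_additive[of "distr L ?N g"] by simp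
    show "0 \<le> x \<and> x \<le> y \<and> ereal y < b" using xy by simp
  qed
qed

text \<open>
  Integrability is part of being a solution, since a Bochner integral that does not exist is \<open>0\<close>.
  Values outside \<open>[0, b)\<close> are irrelevant.
\<close>

definition string_solution ::
  "ereal \<Rightarrow> (real \<Rightarrow> real) \<Rightarrow> (real \<Rightarrow> real) \<Rightarrow> complex \<Rightarrow> (real \<Rightarrow> complex) \<Rightarrow> (real \<Rightarrow> complex) \<Rightarrow> bool"
where
  "string_solution b W R z u\<^sub>1 u\<^sub>2 \<longleftrightarrow>
     (\<forall>x \<in> half_open b.
        set_integrable (stieltjes_measure b R) {0..<x} u\<^sub>2 \<and>
        set_integrable (stieltjes_measure b W) {0..<x} u\<^sub>1 \<and>
        u\<^sub>1 x = u\<^sub>1 0 + (LINT t:{0..<x}|stieltjes_measure b R. u\<^sub>2 t) \<and>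
        u\<^sub>2 x = u\<^sub>2 0 - z * (LINT t:{0..<x}|stieltjes_measure b W. u\<^sub>1 t))"

definition square_integrable :: "ereal \<Rightarrow> (real \<Rightarrow> real) \<Rightarrow> (real \<Rightarrow> complex) \<Rightarrow> bool" where
  "square_integrable b W f \<longleftrightarrow>
     set_borel_measurable (stieltjes_measure b W) {x. 0 < x \<and> ereal x < b} f \<and>
     set_integrable (stieltjes_measure b W) {x. 0 < x \<and> ereal x < b} (\<lambda>x. (cmod (f x))\<^sup>2)"

text \<open>
  \<open>c\<close> and \<open>s\<close> are determined by their initial values only on \<open>[0, b)\<close>, hence they are quantified
  inside the description of \<open>m\<close>.
\<close>

definition neumann_m :: "ereal \<Rightarrow> (real \<Rightarrow> real) \<Rightarrow> (real \<Rightarrow> real) \<Rightarrow> complex \<Rightarrow> complex" where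
  "neumann_m b W R z =
     (THE m. \<exists>c c\<^sub>1 s s\<^sub>1.
        string_solution b W R z c c\<^sub>1 \<and> c 0 = 1 \<and> c\<^sub>1 0 = 0 \<and>
        string_solution b W R z s s\<^sub>1 \<and> s 0 = 0 \<and> s\<^sub>1 0 = 1 \<and>
        square_integrable b W (\<lambda>x. s x - m * c x))"

definition gen_inverse :: "ereal \<Rightarrow> (real \<Rightarrow> real) \<Rightarrow> real \<Rightarrow> real" where
  "gen_inverse b f x = Inf {y. 0 < y \<and> ereal y < b \<and> x \<le> f y}"

definition positively_increasing_at_top :: "(real \<Rightarrow> real) \<Rightarrow> bool" where
  "positively_increasing_at_top f \<longleftrightarrow>
     mono_on {0<..} f \<and> (\<exists>t\<in>{0<..<1}. Limsup at_top (\<lambda>x. ereal (f (x * t) / f x)) \<noteq> 1)"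

end

theory Submission
  imports Defs
begin

text \<open>
  Let \<open>\<psi> = (u\<^sub>1, u\<^sub>2)\<close> be the Weyl solution at the spectral parameter \<open>\<i> y\<close>, \<open>y > 0\<close>, with initial values
  \<open>(- m, 1)\<close>.  Integration by parts, valid because \<open>dW\<close> and \<open>dR\<close> share no atoms, gives the energy
  identity for \<open>cnj u\<^sub>1 u\<^sub>2\<close>.  It follows that on every interval \<open>[0, x)\<close> the integral of \<open>\<bar>u\<^sub>2\<bar>\<^sup>2\<close> with
  respect to \<open>dR\<close> is at most \<open>Re m\<close>, and \<open>y\<close> times the integral of \<open>\<bar>u\<^sub>1\<bar>\<^sup>2\<close> with respect to \<open>dW\<close> is at
  most \<open>Im m\<close> (\<open>neumann_m_weyl_solution\<close>).  Combined with the Cauchy--Schwarz inequality these bounds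
  control the increments of \<open>u\<^sub>1\<close> and \<open>u\<^sub>2\<close> and lead to two estimates, for all \<open>x\<close> in \<open>[0, b)\<close>:

  \<^item> if \<open>y W(x) \<bar>m\<bar> > 4\<close>, then \<open>\<bar>m\<bar>\<^sup>2 \<le> 4 R(x) Re m\<close> (\<open>weyl_upper_bound\<close>);

  \<^item> if \<open>4 y W(x) \<bar>m\<bar> \<le> 1\<close>, then \<open>R(x) \<le> 4 Re m\<close> (\<open>weyl_lower_bound\<close>).

  Thus, jumps aside, \<open>\<bar>m\<bar>\<close> is comparable to \<open>R\<close> at the point where \<open>W R\<close> passes the level \<open>1 / y\<close>.  If \<open>f = W \<circ> R\<^sup>-\<^sup>1\<close>
  is positively increasing, both estimates can be used at points whose \<open>R\<close>-values differ only by a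
  constant factor, and \<open>Re m\<close> is bounded below by a multiple of \<open>\<bar>m\<bar>\<close> (\<open>bounded_ratio_if_growth\<close>).  If
  \<open>f\<close> is not positively increasing, there are long windows on which \<open>W\<close> hardly changes; for \<open>y\<close> tuned
  to the middle of such a window the string behaves like a single point mass followed by a long
  massless part, for which \<open>m\<close> is nearly purely imaginary (\<open>positively_increasing_if_bounded_ratio\<close>).

  The existence of \<open>m\<close> is part of the argument.  The fundamental solutions are power series in the
  spectral parameter, whose terms are iterated integrals with factorial decay.  The value \<open>m\<close> is
  obtained as a limit point of \<open>s(x) / c(x)\<close> for \<open>x \<rightarrow> b\<close>; it is unique because \<open>\<bar>c\<bar> \<ge> 1\<close> on the
  imaginary axis and \<open>W\<close> is unbounded.
\<close>

section \<open>Lebesgue--Stieltjes measures\<close>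

lemma set_lint_nonneg:
  fixes g :: "'a \<Rightarrow> real"
  assumes "\<And>t. t \<in> A \<Longrightarrow> 0 \<le> g t"
  shows "0 \<le> (LINT t:A|M. g t)"
  unfolding set_lebesgue_integral_def
  using assms by (intro Bochner_Integration.integral_nonneg) (auto simp: indicator_def)

lemma Re_set_lint_nonneg:
  fixes f :: "'a \<Rightarrow> complex"
  assumes f: "set_integrable M A f" and nn: "\<And>t. t \<in> A \<Longrightarrow> 0 \<le> Re (f t)"
  shows "0 \<le> Re (LINT t:A|M. f t)"
proof -
  have "Re (LINT t:A|M. f t) = (LINT t|M. Re (indicator A t *\<^sub>R f t))"
    using f unfolding set_integrable_def set_lebesgue_integral_def by (rule integral_Re[symmetric])
  also have "\<dots> \<ge> 0" using nn by (intro Bochner_Integration.integral_nonneg) (auto simp: indicator_def)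
  finally show ?thesis .
qed

lemma tendsto_set_lint_affine:
  fixes f g :: "'a \<Rightarrow> complex"
  assumes f: "set_integrable M A f" "set_integrable M A (\<lambda>t. (cmod (f t))\<^sup>2)"
    and g: "set_integrable M A g" "set_integrable M A (\<lambda>t. (cmod (g t))\<^sup>2)"
    and m: "m \<longlonglongrightarrow> l"
  shows "(\<lambda>k. LINT t:A|M. (cmod (f t - m k * g t))\<^sup>2) \<longlonglongrightarrow> (LINT t:A|M. (cmod (f t - l * g t))\<^sup>2)"
proof -
  obtain B where B: "\<And>k. cmod (m k) \<le> B"
    using convergentI[OF m, THEN convergent_imp_Bseq] unfolding Bseq_def by blast
  let ?f = "\<lambda>t. indicator A t *\<^sub>R f t" and ?g = "\<lambda>t. indicator A t *\<^sub>R g t"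
  have [measurable]: "?f \<in> borel_measurable M" "?g \<in> borel_measurable M"
    using f(1) g(1) unfolding set_integrable_def by auto
  have e: "indicator A t *\<^sub>R (cmod (f t - k * g t))\<^sup>2 = (cmod (?f t - k * ?g t))\<^sup>2" for t k
    by (auto simp: indicator_def)
  show ?thesis unfolding set_lebesgue_integral_def e
  proof (rule integral_dominated_convergence)
    show "integrable M (\<lambda>t. indicator A t *\<^sub>R (2 * (cmod (f t))\<^sup>2 + 2 * B\<^sup>2 * (cmod (g t))\<^sup>2))"
      using f(2) g(2) unfolding set_integrable_def[symmetric]
      by (intro set_integral_add set_integrable_mult_right)
    show "AE t in M. (\<lambda>k. (cmod (?f t - m k * ?g t))\<^sup>2) \<longlonglongrightarrow> (cmod (?f t - l * ?g t))\<^sup>2"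
      by (intro AE_I2 tendsto_intros m)
    show "AE t in M. norm ((cmod (?f t - m k * ?g t))\<^sup>2)
        \<le> indicator A t *\<^sub>R (2 * (cmod (f t))\<^sup>2 + 2 * B\<^sup>2 * (cmod (g t))\<^sup>2)" for k
    proof (intro AE_I2)
      fix t
      have "cmod (f t - m k * g t) \<le> cmod (f t) + B * cmod (g t)"
        using norm_triangle_ineq4[of "f t" "m k * g t"] mult_right_mono[OF B, of "cmod (g t)"]
        by (simp add: norm_mult) (smt (verit) B norm_ge_zero)
      then have "(cmod (f t - m k * g t))\<^sup>2 \<le> (cmod (f t) + B * cmod (g t))\<^sup>2"
        by (intro power_mono) auto
      also have "\<dots> \<le> 2 * (cmod (f t))\<^sup>2 + 2 * B\<^sup>2 * (cmod (g t))\<^sup>2"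
        using zero_le_power2[of "cmod (f t) - B * cmod (g t)"]
        by (simp add: power2_sum power2_diff power_mult_distrib)
      finally show "norm ((cmod (?f t - m k * ?g t))\<^sup>2)
        \<le> indicator A t *\<^sub>R (2 * (cmod (f t))\<^sup>2 + 2 * B\<^sup>2 * (cmod (g t))\<^sup>2)"
        by (auto simp: indicator_def)
    qed
  qed measurable
qed

lemma set_integrable_complex_of_real:
  "set_integrable M A (\<lambda>t. complex_of_real (f t)) \<longleftrightarrow> set_integrable M A f"
proof -
  have "indicator A t *\<^sub>R complex_of_real (f t) = complex_of_real (indicator A t *\<^sub>R f t)" for t
    by (simp add: scaleR_conv_of_real)
  then show ?thesis unfolding set_integrable_def by (simp only: complex_of_real_integrable_eq)
qed

lemma half_open_downward: "0 \<le> x \<Longrightarrow> x \<le> y \<Longrightarrow> y \<in> half_open b \<Longrightarrow> x \<in> half_open b"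
  unfolding half_open_def by (auto intro: le_less_trans[of "ereal x" "ereal y"])

lemma half_open_Icc: "t \<in> {0..x} \<Longrightarrow> x \<in> half_open b \<Longrightarrow> t \<in> half_open b"
  using half_open_downward[of t x b] by auto

lemma sets_stieltjes_measure:
  "sets (stieltjes_measure b F) = sigma_sets (half_open b)
     ((\<lambda>(x, y). {x..<y}) ` {(x, y). 0 \<le> x \<and> x \<le> y \<and> ereal y < b})"
  unfolding stieltjes_measure_def by (rule sets_extend_measure[OF half_open_subset_Pow])

lemma stieltjes_interval_sets [measurable, simp]:
  assumes "y \<in> half_open b" "0 \<le> x"
  shows "{x..<y} \<in> sets (stieltjes_measure b F)"
proof (cases "x \<le> y")
  case True
  then show ?thesis using assms unfolding sets_stieltjes_measure
    by (intro sigma_sets.Basic) (auto simp: half_open_def)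
qed auto

lemma ident_measurable_stieltjes [measurable]: "(\<lambda>x. x) \<in> borel_measurable (stieltjes_measure b F)"
  unfolding borel_measurable_iff_less
proof
  fix a :: real
  consider "a \<le> 0" | "0 < a" "a \<in> half_open b" | "0 < a" "a \<notin> half_open b" by linarith
  then show "{w \<in> space (stieltjes_measure b F). w < a} \<in> sets (stieltjes_measure b F)"
  proof cases
    case 1
    then have "{w \<in> space (stieltjes_measure b F). w < a} = {}"
      by (auto simp: half_open_def)
    then show ?thesis by (metis sets.empty_sets)
  next
    case 2
    then have "{w \<in> space (stieltjes_measure b F). w < a} = {0..<a}"
      using half_open_downward[of _ a b] by (auto simp: half_open_def)
    then show ?thesis using 2 by simp
  next
    case 3
    then have "{w \<in> space (stieltjes_measure b F). w < a} = space (stieltjes_measure b F)"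
      by (auto simp: half_open_def) (metis ereal_less_eq(3) le_less_trans linorder_not_less less_imp_le)
    then show ?thesis by (metis sets.top)
  qed
qed

text \<open>
  The standing assumptions on a single coefficient \<open>F\<close> of the string: nondecreasing and
  left-continuous on \<open>[0, b)\<close>, vanishing at \<open>0\<close> and unbounded.  Both \<open>W\<close> and \<open>R\<close> satisfy them.
\<close>

locale stieltjes =
  fixes b :: ereal and F :: "real \<Rightarrow> real"
  assumes b_pos: "0 < b"
    and mono: "mono_on (half_open b) F"
    and left: "\<And>x. 0 < x \<Longrightarrow> ereal x < b \<Longrightarrow> continuous (at_left x) F"
    and F0: "F 0 = 0"
    and unbdd: "\<not> bdd_above (F ` half_open b)"
begin

abbreviation M where "M \<equiv> stieltjes_measure b F"

lemma zero_mem: "0 \<in> half_open b"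
  using b_pos by (auto simp: half_open_def zero_ereal_def)

lemma nonneg: "x \<in> half_open b \<Longrightarrow> 0 \<le> F x"
  using mono_onD[OF mono zero_mem, of x] F0 by (auto simp: half_open_def)

lemma mono': "0 \<le> x \<Longrightarrow> x \<le> y \<Longrightarrow> y \<in> half_open b \<Longrightarrow> F x \<le> F y"
  using mono_onD[OF mono, of x y] half_open_downward by blast

lemma emeasure_interval:
  "0 \<le> x \<Longrightarrow> x \<le> y \<Longrightarrow> y \<in> half_open b \<Longrightarrow> emeasure M {x..<y} = ennreal (F y - F x)"
  using emeasure_stieltjes_measure[OF mono left F0 unbdd, of x y] by (simp add: half_open_def)

lemma measure_interval:
  "0 \<le> x \<Longrightarrow> x \<le> y \<Longrightarrow> y \<in> half_open b \<Longrightarrow> measure M {x..<y} = F y - F x"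
  using emeasure_interval[of x y] mono'[of x y] by (simp add: measure_def)

lemma emeasure_interval_finite [simp]:
  "0 \<le> x \<Longrightarrow> y \<in> half_open b \<Longrightarrow> emeasure M {x..<y} \<noteq> top"
  by (cases "x \<le> y") (auto simp: emeasure_interval)

lemma set_integrable_const:
  "0 \<le> u \<Longrightarrow> x \<in> half_open b \<Longrightarrow> set_integrable M {u..<x} (\<lambda>_. k :: 'a :: {banach, second_countable_topology})"
  unfolding set_integrable_def
  
  by (intro integrable_scaleR_left integrable_real_indicator)
    (auto simp: less_top[symmetric])

lemma set_lint_const:
  "0 \<le> u \<Longrightarrow> u \<le> x \<Longrightarrow> x \<in> half_open b \<Longrightarrow>
     (LINT t:{u..<x}|M. (k :: 'a :: {banach, second_countable_topology})) = (F x - F u) *\<^sub>R k"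
  using emeasure_interval_finite[of u x]
  by (subst set_integral_const) (auto simp: measure_interval simp del: emeasure_interval_finite)

sublocale sigma_finite_measure M
proof
  let ?A = "(\<lambda>q. {0..<q}) ` {real_of_rat q |q. real_of_rat q \<in> half_open b}"
  have "countable ?A" by (intro countable_image) (simp add: full_SetCompr_eq setcompr_eq_image)
  moreover have "?A \<subseteq> sets M" by auto
  moreover have "\<Union> ?A = space M"
  proof
    show "\<Union> ?A \<subseteq> space M"
      using half_open_downward[OF _ less_imp_le, of _ _ b] by auto
    show "space M \<subseteq> \<Union> ?A"
    proof
      fix x assume "x \<in> space M"
      then have x: "0 \<le> x" "ereal x < b" by (auto simp: half_open_def)
      obtain y where y: "x < y" "ereal y < b"
        using ereal_dense2[OF x(2)] by auto
      obtain q where q: "x < real_of_rat q" "real_of_rat q < y" using of_rat_dense[OF y(1)] by auto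
      then have "real_of_rat q \<in> half_open b"
        using x y less_trans[of "ereal (real_of_rat q)" "ereal y" b] unfolding half_open_def
        by (smt (verit) less_ereal.simps(1) mem_Collect_eq)
      then show "x \<in> \<Union> ?A" using q x by fastforce
    qed
  qed
  moreover have "\<forall>a\<in>?A. emeasure M a \<noteq> \<infinity>" by auto
  ultimately show "\<exists>A. countable A \<and> A \<subseteq> sets M \<and> \<Union> A = space M \<and> (\<forall>a\<in>A. emeasure M a \<noteq> \<infinity>)"
    by blast
qed

lemma singleton_sets [simp]: "x \<in> half_open b \<Longrightarrow> {x} \<in> sets M"
proof -
  assume x: "x \<in> half_open b"
  have "{w \<in> space M. w = x} \<in> sets M" by measurable
  moreover have "{w \<in> space M. w = x} = {x}" using x by auto
  ultimately show ?thesis by simp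
qed

lemma exhausting_sequence:
  "\<exists>X :: nat \<Rightarrow> real. incseq X \<and> (\<forall>n. X n \<in> half_open b) \<and>
     (\<forall>x\<in>half_open b. eventually (\<lambda>n. x < X n) sequentially)"
proof -
  obtain X :: "nat \<Rightarrow> real" where X: "incseq X" "\<And>i. 0 < ereal (X i)" "\<And>i. ereal (X i) < b"
    "(\<lambda>i. ereal (X i)) \<longlonglongrightarrow> b"
    using ereal_incseq_approx[OF b_pos] by (metis (no_types))
  have "eventually (\<lambda>n. x < X n) sequentially" if "x \<in> half_open b" for x
    using order_tendstoD(1)[OF X(4), of "ereal x"] that by (simp add: half_open_def)
  then show ?thesis using X by (intro exI[of _ X]) (auto simp: half_open_def intro: less_imp_le)
qed

lemma measure_singleton_le:
  assumes "x < y" "x \<in> half_open b" "y \<in> half_open b"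
  shows "measure M {x} \<le> F y - F x"
proof -
  have "0 \<le> x" using assms by (auto simp: half_open_def)
  then have "measure M {x} \<le> measure M {x..<y}"
    using assms by (intro measure_mono_fmeasurable) (auto simp: fmeasurable_def less_top[symmetric])
  then show ?thesis using measure_interval[of x y] assms \<open>0 \<le> x\<close> by simp
qed

lemma exists_greater: "x \<in> half_open b \<Longrightarrow> \<exists>y>x. y \<in> half_open b"
  using ereal_dense2[of x b] by (force simp: half_open_def)

lemma unbounded: "\<exists>x\<in>half_open b. k < F x"
  using unbdd unfolding bdd_above_def by (metis imageE not_le)

lemma emeasure_singleton_finite [simp]:
  assumes x: "x \<in> half_open b"
  shows "emeasure M {x} \<noteq> top"
proof -
  obtain y where y: "y > x" "y \<in> half_open b" using exists_greater[OF x] by auto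
  have "0 \<le> x" using x by (auto simp: half_open_def)
  have "emeasure M {x} \<le> emeasure M {x..<y}" using y \<open>0 \<le> x\<close> by (intro emeasure_mono) auto
  also have "\<dots> < top" using y \<open>0 \<le> x\<close> by (simp add: less_top[symmetric])
  finally show ?thesis by simp
qed

lemma continuous_approx_right:
  assumes x: "x \<in> half_open b" and cont: "continuous (at x within half_open b) F" and e: "0 < e"
  shows "\<exists>y>x. y \<in> half_open b \<and> F y < F x + e"
proof -
  obtain d where d: "d > 0" "\<And>y. y \<in> half_open b \<Longrightarrow> dist y x < d \<Longrightarrow> dist (F y) (F x) < e"
    using cont e unfolding continuous_within_eps_delta by metis
  obtain y where y: "y > x" "y \<in> half_open b" using exists_greater[OF x] by auto
  define y' where "y' = min y (x + d/2)"
  have "0 \<le> x" using x by (auto simp: half_open_def)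
  then have y': "x < y'" "y' \<in> half_open b" "dist y' x < d"
    using d y half_open_downward[of y' y b] by (auto simp: y'_def dist_real_def)
  then show ?thesis using d(2)[OF y'(2,3)] by (auto simp: dist_real_def intro!: exI[of _ y'])
qed

lemma measure_singleton_continuous:
  assumes x: "x \<in> half_open b" and cont: "continuous (at x within half_open b) F"
  shows "emeasure M {x} = 0"
proof -
  have "measure M {x} \<le> e" if "e > 0" for e
    using continuous_approx_right[OF x cont that] measure_singleton_le[OF _ x] by fastforce
  then have "measure M {x} \<le> 0" using field_le_epsilon[of "measure M {x}" 0] by simp
  then have "measure M {x} = 0" by (simp add: measure_le_0_iff)
  then show ?thesis using x by (auto simp: measure_def enn2real_eq_0_iff less_top)
qed

end

section \<open>Integration by parts\<close>

locale stieltjes_pair = A: stieltjes b F + B: stieltjes b G for b F G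
begin

sublocale P: pair_sigma_finite A.M B.M ..

text \<open>
  The product of the integrals of \<open>f\<close> and \<open>g\<close> over \<open>[0, x)\<close> is an integral over a square, which is
  split into the two triangles and the diagonal.  The triangles give the usual two terms, because
  the primitives \<open>U\<close> and \<open>V\<close> integrate over \<open>[0, t)\<close> and so ignore an atom at \<open>t\<close>; the diagonal
  collects the atoms that the two measures share.
\<close>

lemma product_rule:
  fixes f g :: "real \<Rightarrow> 'a :: {real_normed_field, banach, second_countable_topology}"
  assumes x: "x \<in> half_open b"
    and f: "set_integrable A.M {0..<x} f" and g: "set_integrable B.M {0..<x} g"
    and U: "\<And>t. t \<in> {0..x} \<Longrightarrow> U t = u + (LINT s:{0..<t}|A.M. f s)"
    and V: "\<And>t. t \<in> {0..x} \<Longrightarrow> V t = v + (LINT s:{0..<t}|B.M. g s)"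
  shows "set_integrable B.M {0..<x} (\<lambda>t. U t * g t)"
    and "set_integrable A.M {0..<x} (\<lambda>t. f t * V t)"
    and "set_integrable B.M {0..<x} (\<lambda>t. measure A.M {t} *\<^sub>R (f t * g t))"
    and "U x * V x = u * v + (LINT t:{0..<x}|B.M. U t * g t) + (LINT t:{0..<x}|A.M. f t * V t)
           + (LINT t:{0..<x}|B.M. measure A.M {t} *\<^sub>R (f t * g t))"
proof -
  have x0: "0 \<le> x" using x by (auto simp: half_open_def)
  define f' where "f' t = indicator {0..<x} t *\<^sub>R f t" for t
  define g' where "g' t = indicator {0..<x} t *\<^sub>R g t" for t
  have f': "integrable A.M f'" and g': "integrable B.M g'"
    using f g unfolding f'_def g'_def set_integrable_def by auto
  note [measurable] = borel_measurable_integrable[OF f'] borel_measurable_integrable[OF g']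
  let ?N = "A.M \<Otimes>\<^sub>M B.M"
  have p: "fst \<in> borel_measurable ?N" "snd \<in> borel_measurable ?N"
    by (rule measurable_compose[OF measurable_fst ident_measurable_stieltjes]
        measurable_compose[OF measurable_snd ident_measurable_stieltjes])+
  note regions = borel_measurable_less[OF p] borel_measurable_less[OF p(2) p(1)] borel_measurable_eq[OF p]
  have H: "integrable (A.M \<Otimes>\<^sub>M B.M) (\<lambda>p. f' (fst p) * g' (snd p))"
  proof (rule P.Fubini_integrable)
    show "integrable A.M (\<lambda>x. LINT y|B.M. norm (f' (fst (x, y)) * g' (snd (x, y))))"
      using f' by (simp add: norm_mult)
    show "AE x in A.M. integrable B.M (\<lambda>y. f' (fst (x, y)) * g' (snd (x, y)))"
      using g' by simp
  qed measurable
  define h1 where "h1 s t = (if s < t then f' s * g' t else 0)" for s t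
  define h2 where "h2 s t = (if t < s then f' s * g' t else 0)" for s t
  define h3 where "h3 s t = (if s = t then f' s * g' t else 0)" for s t
  have h: "integrable (A.M \<Otimes>\<^sub>M B.M) (case_prod h1)" "integrable (A.M \<Otimes>\<^sub>M B.M) (case_prod h2)"
    "integrable (A.M \<Otimes>\<^sub>M B.M) (case_prod h3)"
    unfolding h1_def h2_def h3_def split_beta
    by (rule Bochner_Integration.integrable_bound[OF H],
        rule measurable_If[OF borel_measurable_integrable[OF H] measurable_const], simp, rule regions, simp)+
  have D: "t \<in> space A.M" "t \<in> space B.M" "{t} \<in> sets A.M" if "0 \<le> t" "t < x" for t
    using half_open_downward[OF that(1) _ x] that by auto
  have i1: "(LINT s|A.M. h1 s t) = indicator {0..<x} t *\<^sub>R ((U t - u) * g t)" for t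
  proof (cases "t \<in> {0..<x}")
    case True
    have "(LINT s|A.M. h1 s t) = (LINT s|A.M. (indicator {0..<t} s *\<^sub>R f s) * g t)"
      using True by (intro Bochner_Integration.integral_cong)
        (auto simp: h1_def f'_def g'_def indicator_def half_open_def)
    also have "\<dots> = (LINT s:{0..<t}|A.M. f s) * g t"
      unfolding set_lebesgue_integral_def by (rule integral_mult_left_zero)
    also have "\<dots> = (U t - u) * g t" using U[of t] True by simp
    finally show ?thesis using True by simp
  qed (simp add: h1_def g'_def cong: if_cong)
  have i2: "(LINT t|B.M. h2 s t) = indicator {0..<x} s *\<^sub>R (f s * (V s - v))" for s
  proof (cases "s \<in> {0..<x}")
    case True
    have "(LINT t|B.M. h2 s t) = (LINT t|B.M. f s * (indicator {0..<s} t *\<^sub>R g t))"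
      using True by (intro Bochner_Integration.integral_cong)
        (auto simp: h2_def f'_def g'_def indicator_def half_open_def)
    also have "\<dots> = f s * (LINT t:{0..<s}|B.M. g t)"
      unfolding set_lebesgue_integral_def by (rule integral_mult_right_zero)
    also have "\<dots> = f s * (V s - v)" using V[of s] True by simp
    finally show ?thesis using True by simp
  qed (simp add: h2_def f'_def cong: if_cong)
  have i3: "(LINT s|A.M. h3 s t) = indicator {0..<x} t *\<^sub>R (measure A.M {t} *\<^sub>R (f t * g t))" for t
  proof (cases "t \<in> {0..<x}")
    case True
    have "(LINT s|A.M. h3 s t) = (LINT s|A.M. indicator {t} s *\<^sub>R (f t * g t))"
      using True by (intro Bochner_Integration.integral_cong)
        (auto simp: h3_def f'_def g'_def indicator_def)
    also have "\<dots> = measure A.M {t} *\<^sub>R (f t * g t)"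
      using D[of t] True by (subst integral_scaleR_left) (auto simp: less_top[symmetric])
    finally show ?thesis using True by simp
  qed (simp add: h3_def g'_def cong: if_cong)
  have g1: "set_integrable B.M {0..<x} (\<lambda>t. (U t - u) * g t)"
    using P.integrable_snd[OF h(1)] unfolding i1 set_integrable_def .
  have g2: "set_integrable A.M {0..<x} (\<lambda>t. f t * (V t - v))"
    using P.integrable_fst[OF h(2)] unfolding i2 set_integrable_def .
  show g3: "set_integrable B.M {0..<x} (\<lambda>t. measure A.M {t} *\<^sub>R (f t * g t))"
    using P.integrable_snd[OF h(3)] unfolding i3 set_integrable_def .
  have e1: "U t * g t = (U t - u) * g t + u * g t" for t by (simp add: algebra_simps)
  have e2: "f t * V t = f t * (V t - v) + f t * v" for t by (simp add: algebra_simps)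
  show "set_integrable B.M {0..<x} (\<lambda>t. U t * g t)"
    by (subst e1) (intro set_integral_add g1 set_integrable_mult_right g)
  show "set_integrable A.M {0..<x} (\<lambda>t. f t * V t)"
    by (subst e2) (intro set_integral_add g2 set_integrable_mult_left f)
  have I1: "(LINT t:{0..<x}|B.M. U t * g t) = (LINT t|B.M. LINT s|A.M. h1 s t) + u * (V x - v)"
    unfolding i1 using V[of x] x0
    by (subst e1) (simp add: set_integral_add g1 g set_lebesgue_integral_def[symmetric])
  have I2: "(LINT t:{0..<x}|A.M. f t * V t) = (LINT s|A.M. LINT t|B.M. h2 s t) + (U x - u) * v"
    unfolding i2 using U[of x] x0
    by (subst e2) (simp add: set_integral_add g2 f set_lebesgue_integral_def[symmetric])
  have I3: "(LINT t:{0..<x}|B.M. measure A.M {t} *\<^sub>R (f t * g t)) = (LINT t|B.M. LINT s|A.M. h3 s t)"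
    unfolding i3 set_lebesgue_integral_def ..
  have "(U x - u) * (V x - v) = (LINT s|A.M. f' s) * (LINT t|B.M. g' t)"
    using U[of x] V[of x] x0 by (simp add: f'_def g'_def set_lebesgue_integral_def)
  also have "\<dots> = (LINT s|A.M. LINT t|B.M. f' s * g' t)" by simp
  also have "\<dots> = (LINT p|?N. f' (fst p) * g' (snd p))"
    using P.integral_fst[of "\<lambda>s t. f' s * g' t"] H by (simp add: case_prod_beta')
  also have "\<dots> = (LINT p|?N. case_prod h1 p + case_prod h2 p + case_prod h3 p)"
    by (intro Bochner_Integration.integral_cong) (auto simp: h1_def h2_def h3_def split_beta)
  also have "\<dots> = (LINT t|B.M. LINT s|A.M. h1 s t) + (LINT s|A.M. LINT t|B.M. h2 s t)
      + (LINT t|B.M. LINT s|A.M. h3 s t)"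
    using h P.integral_snd[OF h(1)] P.integral_fst[OF h(2)] P.integral_snd[OF h(3)] by simp
  finally show "U x * V x = u * v + (LINT t:{0..<x}|B.M. U t * g t) + (LINT t:{0..<x}|A.M. f t * V t)
           + (LINT t:{0..<x}|B.M. measure A.M {t} *\<^sub>R (f t * g t))"
    unfolding I1 I2 I3 by (simp add: algebra_simps)
qed

end

context stieltjes
begin

text \<open>
  The power \<open>F ^ Suc n\<close> is itself a primitive with respect to \<open>dF\<close>, and the chain rule holds for it
  as an inequality: atoms only make the density larger.
\<close>

lemma power_density:
  "\<exists>a. (\<forall>x\<in>half_open b. set_integrable M {0..<x} a \<and> F x ^ Suc n = (LINT t:{0..<x}|M. a t)) \<and>
       (\<forall>t\<in>half_open b. real (Suc n) * F t ^ n \<le> a t)"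
proof (induction n)
  case 0
  show ?case
    by (rule exI[of _ "\<lambda>_. 1"]) (auto simp: half_open_def set_integrable_const set_lint_const F0)
next
  case (Suc n)
  interpret pr: stieltjes_pair b F F ..
  from Suc obtain a where
    a: "\<And>x. x \<in> half_open b \<Longrightarrow> set_integrable M {0..<x} a"
       "\<And>x. x \<in> half_open b \<Longrightarrow> F x ^ Suc n = (LINT t:{0..<x}|M. a t)"
       "\<And>t. t \<in> half_open b \<Longrightarrow> real (Suc n) * F t ^ n \<le> a t" by blast
  define a' where "a' t = F t ^ Suc n + a t * F t + measure M {t} * a t" for t
  have "set_integrable M {0..<x} a' \<and> F x ^ Suc (Suc n) = (LINT t:{0..<x}|M. a' t)"
    if x: "x \<in> half_open b" for x
  proof -
    have D: "t \<in> half_open b" if "t \<in> {0..x}" for t using that half_open_downward[OF _ _ x] by auto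
    have U: "F t ^ Suc n = 0 + (LINT s:{0..<t}|M. a s)" if "t \<in> {0..x}" for t
      using a(2)[OF D[OF that]] by simp
    have V: "F t = 0 + (LINT s:{0..<t}|M. (1::real))" if "t \<in> {0..x}" for t
      using D[OF that] that by (simp add: set_lint_const F0)
    have one: "set_integrable M {0..<x} (\<lambda>_. 1::real)" using x by (intro set_integrable_const) auto
    note P = pr.product_rule[OF x a(1)[OF x] one U V, simplified]
    show ?thesis unfolding a'_def using P by (simp add: set_integral_add mult.commute)
  qed
  moreover have "real (Suc (Suc n)) * F t ^ Suc n \<le> a' t" if t: "t \<in> half_open b" for t
  proof -
    have "0 \<le> a t" using a(3)[OF t] nonneg[OF t] by (meson mult_nonneg_nonneg of_nat_0_le_iff order_trans zero_le_power)
    moreover have "real (Suc n) * F t ^ n * F t \<le> a t * F t"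
      by (intro mult_right_mono a t nonneg)
    ultimately show ?thesis unfolding a'_def
      by (simp add: algebra_simps add_increasing2)
  qed
  ultimately show ?case by blast
qed

text \<open>
  Primitives with respect to one Stieltjes measure are measurable for every other one, as all of
  them live on the same \<open>\<sigma>\<close>-algebra.
\<close>

lemma running_integral_measurable:
  fixes h :: "real \<Rightarrow> 'a :: {banach, second_countable_topology}"
  assumes h: "h \<in> borel_measurable M"
  shows "(\<lambda>x. LINT t:{0..<x}|M. h t) \<in> borel_measurable (stieltjes_measure b G)"
proof -
  let ?K = "stieltjes_measure b G"
  have p: "fst \<in> borel_measurable (?K \<Otimes>\<^sub>M M)" "snd \<in> borel_measurable (?K \<Otimes>\<^sub>M M)"
    by (rule measurable_compose[OF measurable_fst ident_measurable_stieltjes]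
        measurable_compose[OF measurable_snd ident_measurable_stieltjes])+
  have "case_prod (\<lambda>x t. if t < x then h t else 0) \<in> borel_measurable (?K \<Otimes>\<^sub>M M)"
    unfolding case_prod_beta'
    by (rule measurable_If[OF measurable_compose[OF measurable_snd h] measurable_const])
      (simp, rule borel_measurable_less[OF p(2) p(1)])
  from borel_measurable_lebesgue_integral[OF this]
  have "(\<lambda>x. LINT t|M. (if t < x then h t else 0)) \<in> borel_measurable ?K" .
  moreover have "(LINT t:{0..<x}|M. h t) = (LINT t|M. (if t < x then h t else 0))" for x
    unfolding set_lebesgue_integral_def
    by (intro Bochner_Integration.integral_cong) (auto simp: half_open_def indicator_def)
  ultimately show ?thesis by simp
qed

lemma as_integral: "x \<in> half_open b \<Longrightarrow> F x = (LINT t:{0..<x}|M. 1)"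
  by (subst set_lint_const) (auto simp: half_open_def F0)

lemma measurable_F [measurable]: "F \<in> borel_measurable (stieltjes_measure b G)"
  using running_integral_measurable[of "\<lambda>_. 1::real" G]
  by (subst measurable_cong[OF as_integral]) auto

lemma set_integrable_bounded:
  fixes h :: "real \<Rightarrow> 'a :: {banach, second_countable_topology}"
  assumes "x \<in> half_open b" "0 \<le> u" "h \<in> borel_measurable M"
    and "\<And>t. t \<in> {u..<x} \<Longrightarrow> norm (h t) \<le> B"
  shows "set_integrable M {u..<x} h"
proof (rule set_integrable_bound)
  show "set_integrable M {u..<x} (\<lambda>_. B)" using assms by (intro set_integrable_const) auto
  show "set_borel_measurable M {u..<x} h" using assms unfolding set_borel_measurable_def
    by (intro borel_measurable_scaleR borel_measurable_indicator) auto
qed (use assms(4) in \<open>fastforce intro: AE_I2\<close>)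

lemma set_lint_sums:
  fixes f :: "nat \<Rightarrow> real \<Rightarrow> 'a :: {banach, second_countable_topology}"
  assumes x: "x \<in> half_open b" and f: "\<And>n. f n \<in> borel_measurable M"
    and B: "\<And>n t. t \<in> {0..<x} \<Longrightarrow> norm (f n t) \<le> B n" "summable B"
  shows "set_integrable M {0..<x} (\<lambda>t. \<Sum>n. f n t)"
    and "(\<lambda>n. LINT t:{0..<x}|M. f n t) sums (LINT t:{0..<x}|M. (\<Sum>n. f n t))"
proof -
  have x0: "0 \<le> x" using x by (auto simp: half_open_def)
  let ?f = "\<lambda>n t. indicator {0..<x} t *\<^sub>R f n t"
  have i: "integrable M (?f n)" for n
    using set_integrable_bounded[OF x _ f B(1)] unfolding set_integrable_def by simp
  have "summable (\<lambda>n. norm (?f n t))" for t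
    using B(1)[of t] by (cases "t \<in> {0..<x}") (auto intro!: summable_comparison_test[OF _ B(2)])
  then have s1: "AE t in M. summable (\<lambda>n. norm (?f n t))" by simp
  have "norm (LINT t|M. norm (?f n t)) \<le> F x * B n" for n
  proof -
    have "(LINT t|M. norm (?f n t)) \<le> (LINT t:{0..<x}|M. B n)"
      unfolding set_lebesgue_integral_def
      by (intro integral_mono integrable_norm i set_integrable_const[OF order_refl x, unfolded set_integrable_def])
        (use B(1) in \<open>auto simp: indicator_def\<close>)
    also have "\<dots> = F x * B n" using x x0 by (subst set_lint_const) (auto simp: F0)
    finally show ?thesis by simp
  qed
  then have s2: "summable (\<lambda>n. LINT t|M. norm (?f n t))"
    by (intro summable_comparison_test[OF _ summable_mult[OF B(2), of "F x"]]) auto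
  have e: "(\<Sum>n. ?f n t) = indicator {0..<x} t *\<^sub>R (\<Sum>n. f n t)" for t
    by (cases "t \<in> {0..<x}") auto
  show "set_integrable M {0..<x} (\<lambda>t. \<Sum>n. f n t)"
    using integrable_suminf[OF i s1 s2] unfolding e set_integrable_def .
  show "(\<lambda>n. LINT t:{0..<x}|M. f n t) sums (LINT t:{0..<x}|M. (\<Sum>n. f n t))"
    using sums_integral[OF i s1 s2] unfolding e set_lebesgue_integral_def .
qed

lemma set_integrable_power: "x \<in> half_open b \<Longrightarrow> set_integrable M {0..<x} (\<lambda>t. F t ^ n)"
proof (rule set_integrable_bounded[where B = "F x ^ n"])
  fix t assume t: "t \<in> {0..<x}" and x: "x \<in> half_open b"
  then show "norm (F t ^ n) \<le> F x ^ n"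
    using nonneg[OF half_open_downward[of t x b]] mono'[of t x]
    by (auto simp: norm_power intro: power_mono)
qed auto

lemma set_lint_power_le:
  assumes x: "x \<in> half_open b"
  shows "(LINT t:{0..<x}|M. F t ^ n) \<le> F x ^ Suc n / real (Suc n)"
proof -
  obtain a where
    a: "\<And>x. x \<in> half_open b \<Longrightarrow> set_integrable M {0..<x} a"
       "\<And>x. x \<in> half_open b \<Longrightarrow> F x ^ Suc n = (LINT t:{0..<x}|M. a t)"
       "\<And>t. t \<in> half_open b \<Longrightarrow> real (Suc n) * F t ^ n \<le> a t"
    using power_density[of n] by blast
  have "real (Suc n) * (LINT t:{0..<x}|M. F t ^ n) = (LINT t:{0..<x}|M. real (Suc n) * F t ^ n)" by simp
  also have "\<dots> \<le> (LINT t:{0..<x}|M. a t)"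
    by (intro set_integral_mono set_integrable_mult_right set_integrable_power x a)
      (use half_open_downward[OF _ _ x] in auto)
  finally show ?thesis using a(2)[OF x] by (simp add: field_simps)
qed

lemma set_lint_Cauchy_Schwarz:
  fixes g :: "real \<Rightarrow> complex"
  assumes v: "0 \<le> v" "v \<le> x" and x: "x \<in> half_open b"
    and g: "set_integrable M {v..<x} g" and g2: "set_integrable M {v..<x} (\<lambda>t. (cmod (g t))\<^sup>2)"
  shows "(cmod (LINT t:{v..<x}|M. g t))\<^sup>2 \<le> (F x - F v) * (LINT t:{v..<x}|M. (cmod (g t))\<^sup>2)"
proof -
  define I where "I = (LINT t:{v..<x}|M. cmod (g t))"
  define J where "J = (LINT t:{v..<x}|M. (cmod (g t))\<^sup>2)"
  define \<mu> where "\<mu> = F x - F v"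
  have gn: "set_integrable M {v..<x} (\<lambda>t. cmod (g t))" using g by (rule set_integrable_norm)
  have quad: "2 * k * I \<le> J + k\<^sup>2 * \<mu>" for k
  proof -
    have "(LINT t:{v..<x}|M. 2 * k * cmod (g t)) \<le> (LINT t:{v..<x}|M. (cmod (g t))\<^sup>2 + k\<^sup>2)"
    proof (intro set_integral_mono set_integrable_mult_right set_integral_add gn g2 set_integrable_const v x)
      fix t show "2 * k * cmod (g t) \<le> (cmod (g t))\<^sup>2 + k\<^sup>2"
        using zero_le_power2[of "cmod (g t) - k"] by (simp add: power2_diff mult_ac)
    qed
    also have "\<dots> = J + k\<^sup>2 * \<mu>"
      using v x by (simp add: set_integral_add g2 set_integrable_const set_lint_const J_def \<mu>_def)
    finally show ?thesis by (simp add: I_def)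
  qed
  have "0 \<le> \<mu>" using mono'[OF v x] by (simp add: \<mu>_def)
  have "I\<^sup>2 \<le> \<mu> * J"
  proof (cases "\<mu> = 0")
    case True
    have "I = 0"
    proof (rule ccontr)
      assume "I \<noteq> 0"
      then show False using quad[of "(J + 1) / (2 * I)"] True by simp
    qed
    then show ?thesis using True by simp
  next
    case False
    then have "\<mu> > 0" using \<open>0 \<le> \<mu>\<close> by simp
    then show ?thesis using quad[of "I / \<mu>"] by (simp add: field_simps power2_eq_square)
  qed
  moreover have "cmod (LINT t:{v..<x}|M. g t) \<le> I"
    unfolding I_def using set_integral_norm_bound[OF g] .
  then have "(cmod (LINT t:{v..<x}|M. g t))\<^sup>2 \<le> I\<^sup>2" by (intro power_mono) auto
  ultimately show ?thesis by (simp add: J_def \<mu>_def)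
qed

lemma set_lint_split:
  fixes g :: "real \<Rightarrow> 'a :: {banach, second_countable_topology}"
  assumes "0 \<le> v" "v \<le> x" "x \<in> half_open b" "set_integrable M {0..<x} g"
  shows "(LINT t:{0..<x}|M. g t) = (LINT t:{0..<v}|M. g t) + (LINT t:{v..<x}|M. g t)"
proof -
  have "v \<in> half_open b" using half_open_downward[OF assms(1,2,3)] .
  then have "set_integrable M {0..<v} g" "set_integrable M {v..<x} g"
    using assms by (auto intro!: set_integrable_subset[OF assms(4)])
  then have "(LINT t:{0..<v} \<union> {v..<x}|M. g t) = (LINT t:{0..<v}|M. g t) + (LINT t:{v..<x}|M. g t)"
    by (intro set_integral_Un) auto
  moreover have "{0..<v} \<union> {v..<x} = {0..<x}" using assms by auto
  ultimately show ?thesis by simp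
qed

lemma set_lint_mono_interval:
  fixes g :: "real \<Rightarrow> real"
  assumes "0 \<le> v" "v \<le> x" "x \<in> half_open b" "set_integrable M {0..<x} g" "\<And>t. 0 \<le> g t"
  shows "(LINT t:{0..<v}|M. g t) \<le> (LINT t:{0..<x}|M. g t)"
    and "(LINT t:{v..<x}|M. g t) \<le> (LINT t:{0..<x}|M. g t)"
  using set_lint_split[OF assms(1-4)] set_lint_nonneg[of "{0..<v}" g] set_lint_nonneg[of "{v..<x}" g]
    assms(5) by auto

end

section \<open>Solutions of the string equation\<close>

text \<open>
  The coefficients of the string.  Continuity within \<open>[0, b)\<close> at \<open>0\<close> is right continuity, so at
  most one of \<open>dW\<close> and \<open>dR\<close> has an atom at \<open>0\<close>.
\<close>

locale string = W: stieltjes b W + R: stieltjes b R for b W R +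
  assumes no_common_discontinuity: "\<And>x. x \<in> half_open b \<Longrightarrow>
    continuous (at x within half_open b) W \<or> continuous (at x within half_open b) R"
begin

sublocale RW: stieltjes_pair b R W ..

lemma no_common_atoms: "AE t in W.M. measure R.M {t} = 0"
proof (rule AE_I')
  let ?C = "{t \<in> half_open b. \<not> continuous (at t within half_open b) R}"
  have "(\<Union>t\<in>?C. {t}) \<in> null_sets W.M"
  proof (rule null_sets_UN')
    show "countable ?C" by (rule mono_on_ctble_discont[OF R.mono])
    fix t assume "t \<in> ?C"
    then show "{t} \<in> null_sets W.M"
      using no_common_discontinuity[of t] W.measure_singleton_continuous[of t] by auto
  qed
  then show "?C \<in> null_sets W.M" by simp
  show "{t \<in> space W.M. measure R.M {t} \<noteq> 0} \<subseteq> ?C"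
    using R.measure_singleton_continuous by (auto simp: measure_def)
qed

text \<open>Since \<open>dW\<close> and \<open>dR\<close> share no atoms, the diagonal term of the general product rule vanishes.\<close>

lemma product_rule:
  fixes f g :: "real \<Rightarrow> 'a :: {real_normed_field, banach, second_countable_topology}"
  assumes x: "x \<in> half_open b"
    and f: "set_integrable R.M {0..<x} f" and g: "set_integrable W.M {0..<x} g"
    and U: "\<And>t. t \<in> {0..x} \<Longrightarrow> U t = u + (LINT s:{0..<t}|R.M. f s)"
    and V: "\<And>t. t \<in> {0..x} \<Longrightarrow> V t = v + (LINT s:{0..<t}|W.M. g s)"
  shows "set_integrable W.M {0..<x} (\<lambda>t. U t * g t)"
    and "set_integrable R.M {0..<x} (\<lambda>t. f t * V t)"
    and "U x * V x = u * v + (LINT t:{0..<x}|W.M. U t * g t) + (LINT t:{0..<x}|R.M. f t * V t)"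
proof -
  note P = RW.product_rule[OF x f g U V]
  show "set_integrable W.M {0..<x} (\<lambda>t. U t * g t)" "set_integrable R.M {0..<x} (\<lambda>t. f t * V t)"
    using P by auto
  have "(LINT t:{0..<x}|W.M. measure R.M {t} *\<^sub>R (f t * g t)) = 0"
    unfolding set_lebesgue_integral_def
    by (rule integral_eq_zero_AE) (use no_common_atoms in \<open>eventually_elim, simp\<close>)
  then show "U x * V x = u * v + (LINT t:{0..<x}|W.M. U t * g t) + (LINT t:{0..<x}|R.M. f t * V t)"
    using P(4) by simp
qed

end

lemma (in string) string_swap: "string b R W"
  by unfold_locales (use no_common_discontinuity in blast)

text \<open>
  The coefficient of \<open>(- z) ^ n\<close> in the expansion of the solution \<open>c\<close> with initial values
  \<open>(1, 0)\<close> in powers of the spectral parameter: an \<open>n\<close>-fold iterated double integral of the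
  constant \<open>1\<close>.
\<close>

primrec neumann_iterate ::
  "ereal \<Rightarrow> (real \<Rightarrow> real) \<Rightarrow> (real \<Rightarrow> real) \<Rightarrow> nat \<Rightarrow> real \<Rightarrow> real"
where
  "neumann_iterate b W R 0 = (\<lambda>x. 1)"
| "neumann_iterate b W R (Suc n) = (\<lambda>x. LINT t:{0..<x}|stieltjes_measure b R.
     LINT s:{0..<t}|stieltjes_measure b W. neumann_iterate b W R n s)"

context string
begin

abbreviation P where "P \<equiv> neumann_iterate b W R"
abbreviation Q where "Q n x \<equiv> (LINT s:{0..<x}|W.M. P n s)"

lemma iterate_Suc: "P (Suc n) x = (LINT t:{0..<x}|R.M. Q n t)" by simp

declare neumann_iterate.simps(2) [simp del]

text \<open>
  Only one of the two integrations in a double step has to produce a factorial; the other factor is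
  estimated by its value at the right endpoint.
\<close>

lemma iterate_bound_step:
  assumes P: "P n \<in> borel_measurable W.M"
    and le: "\<And>x. x \<in> half_open b \<Longrightarrow> 0 \<le> P n x \<and> P n x \<le> (R x * W x) ^ n / fact n"
    and x: "x \<in> half_open b"
  shows "0 \<le> Q n x \<and> Q n x \<le> R x ^ n * W x ^ Suc n / fact (Suc n)"
proof
  show "0 \<le> Q n x"
    unfolding set_lebesgue_integral_def using le half_open_Icc[OF _ x]
    by (intro Bochner_Integration.integral_nonneg) (auto simp: indicator_def)
  have le': "P n t \<le> R x ^ n / fact n * W t ^ n" if t: "t \<in> {0..<x}" for t
  proof -
    have tD: "t \<in> half_open b" using t half_open_Icc[OF _ x] by auto
    have "P n t \<le> R t ^ n * W t ^ n / fact n" using le[OF tD] by (simp add: power_mult_distrib)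
    also have "\<dots> \<le> R x ^ n * W t ^ n / fact n"
      using t x R.mono'[of t x] R.nonneg[OF tD] W.nonneg[OF tD]
      by (intro divide_right_mono mult_right_mono power_mono) auto
    finally show ?thesis by simp
  qed
  have "set_integrable W.M {0..<x} (P n)"
  proof (rule set_integrable_bound[OF _ _ AE_I2])
    show "set_integrable W.M {0..<x} (\<lambda>t. R x ^ n / fact n * W t ^ n)"
      by (intro set_integrable_mult_right W.set_integrable_power x)
    show "set_borel_measurable W.M {0..<x} (P n)" using P x unfolding set_borel_measurable_def
      by (intro borel_measurable_scaleR borel_measurable_indicator) auto
    show "t \<in> {0..<x} \<longrightarrow> norm (P n t) \<le> norm (R x ^ n / fact n * W t ^ n)" for t
    proof
      assume t: "t \<in> {0..<x}"
      then have "t \<in> half_open b" using half_open_Icc[of t x] x by auto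
      then show "norm (P n t) \<le> norm (R x ^ n / fact n * W t ^ n)"
        using le'[OF t] le[of t] unfolding real_norm_def by linarith
    qed
  qed
  then have "Q n x \<le> (LINT t:{0..<x}|W.M. R x ^ n / fact n * W t ^ n)"
    by (intro set_integral_mono set_integrable_mult_right W.set_integrable_power x le')
  also have "\<dots> = R x ^ n / fact n * (LINT t:{0..<x}|W.M. W t ^ n)" by simp
  also have "\<dots> \<le> R x ^ n / fact n * (W x ^ Suc n / real (Suc n))"
    using R.nonneg[OF x] by (intro mult_left_mono W.set_lint_power_le x) auto
  also have "\<dots> = R x ^ n * W x ^ Suc n / fact (Suc n)" by (simp add: field_simps)
  finally show "Q n x \<le> R x ^ n * W x ^ Suc n / fact (Suc n)" .
qed

lemma iterate_bound:
  "P n \<in> borel_measurable W.M \<and>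
     (\<forall>x\<in>half_open b. 0 \<le> P n x \<and> P n x \<le> (R x * W x) ^ n / fact n)"
proof (induction n)
  case (Suc n)
  then have P: "P n \<in> borel_measurable W.M"
    and le: "\<And>x. x \<in> half_open b \<Longrightarrow> 0 \<le> P n x \<and> P n x \<le> (R x * W x) ^ n / fact n" by auto
  have Q: "0 \<le> Q n x \<and> Q n x \<le> R x ^ n * W x ^ Suc n / fact (Suc n)" if "x \<in> half_open b" for x
    using iterate_bound_step[OF P le that] .
  have Qm: "Q n \<in> borel_measurable R.M" by (rule W.running_integral_measurable[OF P])
  have "0 \<le> P (Suc n) x \<and> P (Suc n) x \<le> (R x * W x) ^ Suc n / fact (Suc n)"
    if x: "x \<in> half_open b" for x
  proof
    have x0: "0 \<le> x" using x by (auto simp: half_open_def)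
    show "0 \<le> P (Suc n) x"
      unfolding iterate_Suc set_lebesgue_integral_def[of _ _ "Q n"] using Q half_open_Icc[OF _ x]
      by (intro Bochner_Integration.integral_nonneg) (auto simp: indicator_def)
    have le': "Q n t \<le> R x ^ n * W x ^ Suc n / fact (Suc n)" if t: "t \<in> {0..<x}" for t
    proof -
      have tD: "t \<in> half_open b" using t half_open_Icc[OF _ x] by auto
      have "Q n t \<le> R t ^ n * W t ^ Suc n / fact (Suc n)" using Q[OF tD] by simp
      also have "\<dots> \<le> R x ^ n * W x ^ Suc n / fact (Suc n)"
        using t x R.mono'[of t x] R.nonneg[OF tD] W.nonneg[OF tD] W.mono'[of t x] R.nonneg[OF x]
        by (intro divide_right_mono mult_mono power_mono) auto
      finally show ?thesis .
    qed
    have "norm (Q n t) \<le> R x ^ n * W x ^ Suc n / fact (Suc n)" if "t \<in> {0..<x}" for t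
      using le'[OF that] Q[of t] half_open_Icc[of t x] x that by auto
    then have "set_integrable R.M {0..<x} (Q n)"
      by (intro R.set_integrable_bounded x Qm) auto
    then have "P (Suc n) x \<le> (LINT t:{0..<x}|R.M. R x ^ n * W x ^ Suc n / fact (Suc n))"
      unfolding iterate_Suc by (intro set_integral_mono R.set_integrable_const x le') auto
    also have "\<dots> = (R x * W x) ^ Suc n / fact (Suc n)"
      using x x0 by (subst R.set_lint_const) (auto simp: R.F0 power_mult_distrib)
    finally show "P (Suc n) x \<le> (R x * W x) ^ Suc n / fact (Suc n)" .
  qed
  moreover have "P (Suc n) \<in> borel_measurable W.M"
    using R.running_integral_measurable[OF Qm] unfolding neumann_iterate.simps(2) .
  ultimately show ?case by blast
qed simp

lemma exists_solution:
  "\<exists>c c\<^sub>1. string_solution b W R z c c\<^sub>1 \<and> c 0 = 1 \<and> c\<^sub>1 0 = 0"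
proof -
  define p where "p n x = (- z) ^ n * complex_of_real (P n x)" for n x
  define q where "q n x = (- z) ^ Suc n * complex_of_real (Q n x)" for n x
  define c where "c x = (\<Sum>n. p n x)" for x
  define d where "d x = (\<Sum>n. q n x)" for x
  have pm: "p n \<in> borel_measurable W.M" and qm: "q n \<in> borel_measurable R.M" for n
    unfolding p_def q_def using iterate_bound[of n] W.running_integral_measurable[of "P n"] by auto
  note Pb = iterate_bound[THEN conjunct2, rule_format]
  have Qb: "0 \<le> Q n x \<and> Q n x \<le> R x ^ n * W x ^ Suc n / fact (Suc n)" if "x \<in> half_open b" for n x
    using iterate_bound_step[OF iterate_bound[THEN conjunct1] Pb that] .
  have step: "set_integrable R.M {0..<x} d \<and> set_integrable W.M {0..<x} c
      \<and> c x = 1 + (LINT t:{0..<x}|R.M. d t) \<and> d x = 0 - z * (LINT t:{0..<x}|W.M. c t)"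
    if x: "x \<in> half_open b" for x
  proof -
    define K where "K = cmod z * (R x * W x)"
    have sK: "summable (\<lambda>n. K ^ n / fact n)"
      using summable_exp[of K] by (simp add: field_simps)
    have pb: "norm (p n t) \<le> K ^ n / fact n" if t: "t \<in> {0..<x}" for n t
    proof -
      have tD: "t \<in> half_open b" using t half_open_Icc[OF _ x] by auto
      have "P n t \<le> (R t * W t) ^ n / fact n" using Pb[OF tD] by simp
      also have "\<dots> \<le> (R x * W x) ^ n / fact n"
        using t x R.mono'[of t x] R.nonneg[OF tD] W.nonneg[OF tD] W.mono'[of t x] R.nonneg[OF x]
        by (intro divide_right_mono mult_mono power_mono) auto
      finally have "cmod z ^ n * P n t \<le> cmod z ^ n * ((R x * W x) ^ n / fact n)"
        by (intro mult_left_mono) auto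
      then show ?thesis using Pb[OF tD, of n]
        by (simp add: p_def norm_mult norm_power K_def power_mult_distrib)
    qed
    have qb: "norm (q n t) \<le> cmod z * W x * (K ^ n / fact n)" if t: "t \<in> {0..<x}" for n t
    proof -
      have tD: "t \<in> half_open b" using t half_open_Icc[OF _ x] by auto
      have "Q n t \<le> R t ^ n * W t ^ Suc n / fact (Suc n)" using Qb[OF tD] by simp
      also have "\<dots> \<le> R x ^ n * W x ^ Suc n / fact (Suc n)"
        using t x R.mono'[of t x] R.nonneg[OF tD] W.nonneg[OF tD] W.mono'[of t x] R.nonneg[OF x]
        by (intro divide_right_mono mult_mono power_mono) auto
      also have "\<dots> \<le> R x ^ n * W x ^ Suc n / fact n"
        using R.nonneg[OF x] W.nonneg[OF x] by (intro divide_left_mono) (auto simp: fact_mono)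
      finally have "cmod z ^ Suc n * Q n t \<le> cmod z ^ Suc n * (R x ^ n * W x ^ Suc n / fact n)"
        by (intro mult_left_mono) auto
      then show ?thesis using Qb[OF tD, of n]
        by (simp add: q_def norm_mult norm_power K_def power_mult_distrib mult_ac)
    qed
    note S1 = W.set_lint_sums[OF x pm pb sK]
    note S2 = R.set_lint_sums[OF x qm qb summable_mult[OF sK]]
    have "(LINT t:{0..<x}|W.M. p n t) = (- z) ^ n * complex_of_real (Q n x)" for n
      unfolding p_def by (simp add: set_integral_complex_of_real)
    then have "(\<lambda>n. - z * ((- z) ^ n * complex_of_real (Q n x))) sums (- z * (LINT t:{0..<x}|W.M. c t))"
      using sums_mult[OF S1(2), of "- z"] by (simp add: c_def)
    have d: "d x = - z * (LINT t:{0..<x}|W.M. c t)"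
      using sums_unique[OF \<open>(\<lambda>n. - z * ((- z) ^ n * complex_of_real (Q n x))) sums _\<close>]
      by (simp add: d_def q_def mult.assoc)
    have "(LINT t:{0..<x}|R.M. q n t) = p (Suc n) x" for n
      unfolding q_def p_def iterate_Suc set_integral_mult_right set_integral_complex_of_real ..
    then have "(\<lambda>n. p (Suc n) x) sums (LINT t:{0..<x}|R.M. d t)"
      using S2(2) by (simp add: d_def)
    then have "(\<lambda>n. p n x) sums ((LINT t:{0..<x}|R.M. d t) + p 0 x)" by (rule sums_Suc)
    from sums_unique[OF this] have c: "c x = (LINT t:{0..<x}|R.M. d t) + 1"
      by (simp add: c_def p_def)
    show ?thesis using S1(1) S2(1) c d by (simp add: c_def[abs_def] d_def[abs_def])
  qed
  have "c 0 = 1" "d 0 = 0" using step[OF W.zero_mem] by (auto simp: set_lebesgue_integral_def)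
  then show ?thesis using step unfolding string_solution_def by metis
qed

lemma lagrange_identity:
  assumes u: "string_solution b W R z u\<^sub>1 u\<^sub>2" and v: "string_solution b W R w v\<^sub>1 v\<^sub>2"
    and w: "w \<noteq> 0" and x: "x \<in> half_open b"
  shows "set_integrable W.M {0..<x} (\<lambda>t. u\<^sub>1 t * v\<^sub>1 t)"
    and "set_integrable R.M {0..<x} (\<lambda>t. u\<^sub>2 t * v\<^sub>2 t)"
    and "u\<^sub>1 x * v\<^sub>2 x = u\<^sub>1 0 * v\<^sub>2 0 - w * (LINT t:{0..<x}|W.M. u\<^sub>1 t * v\<^sub>1 t)
           + (LINT t:{0..<x}|R.M. u\<^sub>2 t * v\<^sub>2 t)"
proof -
  have f: "set_integrable R.M {0..<x} u\<^sub>2" and g0: "set_integrable W.M {0..<x} v\<^sub>1"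
    using u v x unfolding string_solution_def by auto
  have g: "set_integrable W.M {0..<x} (\<lambda>t. - w * v\<^sub>1 t)"
    by (rule set_integrable_mult_right) (rule g0)
  have U: "u\<^sub>1 t = u\<^sub>1 0 + (LINT s:{0..<t}|R.M. u\<^sub>2 s)" if "t \<in> {0..x}" for t
    using u half_open_Icc[OF that x] unfolding string_solution_def by blast
  have V: "v\<^sub>2 t = v\<^sub>2 0 + (LINT s:{0..<t}|W.M. - w * v\<^sub>1 s)" if "t \<in> {0..x}" for t
  proof -
    have "v\<^sub>2 t = v\<^sub>2 0 - w * (LINT s:{0..<t}|W.M. v\<^sub>1 s)"
      using v half_open_Icc[OF that x] unfolding string_solution_def by blast
    then show ?thesis unfolding set_integral_mult_right by simp
  qed
  note P = product_rule[OF x f g U V]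
  have e: "u\<^sub>1 t * (- w * v\<^sub>1 t) = - w * (u\<^sub>1 t * v\<^sub>1 t)" for t by simp
  show "set_integrable W.M {0..<x} (\<lambda>t. u\<^sub>1 t * v\<^sub>1 t)"
    proof -
    have "set_integrable W.M {0..<x} (\<lambda>t. - w * (u\<^sub>1 t * v\<^sub>1 t))" using P(1) unfolding e .
    then show ?thesis using w by (subst (asm) set_integrable_mult_right_iff) auto
  qed
  show "set_integrable R.M {0..<x} (\<lambda>t. u\<^sub>2 t * v\<^sub>2 t)" by (rule P(2))
  show "u\<^sub>1 x * v\<^sub>2 x = u\<^sub>1 0 * v\<^sub>2 0 - w * (LINT t:{0..<x}|W.M. u\<^sub>1 t * v\<^sub>1 t)
           + (LINT t:{0..<x}|R.M. u\<^sub>2 t * v\<^sub>2 t)"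
    using P(3) unfolding e set_integral_mult_right by simp
qed

lemma solution_cnj:
  assumes "string_solution b W R z u\<^sub>1 u\<^sub>2"
  shows "string_solution b W R (cnj z) (\<lambda>x. cnj (u\<^sub>1 x)) (\<lambda>x. cnj (u\<^sub>2 x))"
proof -
  have e: "indicator A x *\<^sub>R cnj (f x) = cnj (indicator A x *\<^sub>R f x)" for A :: "real set" and f x
    by (simp add: scaleR_conv_of_real)
  show ?thesis
    using assms unfolding string_solution_def set_integrable_def set_lebesgue_integral_def e
      Bochner_Integration.integral_cnj complex_integrable_cnj complex_cnj_add[symmetric] complex_cnj_diff[symmetric]
      complex_cnj_mult[symmetric] complex_cnj_cancel_iff .
qed

lemma solution_diff:
  assumes "string_solution b W R z u\<^sub>1 u\<^sub>2" "string_solution b W R z v\<^sub>1 v\<^sub>2"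
  shows "string_solution b W R z (\<lambda>x. u\<^sub>1 x - k * v\<^sub>1 x) (\<lambda>x. u\<^sub>2 x - k * v\<^sub>2 x)"
  unfolding string_solution_def
proof (intro ballI conjI)
  fix x assume x: "x \<in> half_open b"
  have u: "set_integrable R.M {0..<x} u\<^sub>2" "set_integrable W.M {0..<x} u\<^sub>1"
    "u\<^sub>1 x = u\<^sub>1 0 + (LINT t:{0..<x}|R.M. u\<^sub>2 t)" "u\<^sub>2 x = u\<^sub>2 0 - z * (LINT t:{0..<x}|W.M. u\<^sub>1 t)"
    using assms(1) x unfolding string_solution_def by blast+
  have v: "set_integrable R.M {0..<x} v\<^sub>2" "set_integrable W.M {0..<x} v\<^sub>1"
    "v\<^sub>1 x = v\<^sub>1 0 + (LINT t:{0..<x}|R.M. v\<^sub>2 t)" "v\<^sub>2 x = v\<^sub>2 0 - z * (LINT t:{0..<x}|W.M. v\<^sub>1 t)"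
    using assms(2) x unfolding string_solution_def by blast+
  show "set_integrable R.M {0..<x} (\<lambda>x. u\<^sub>2 x - k * v\<^sub>2 x)"
    "set_integrable W.M {0..<x} (\<lambda>x. u\<^sub>1 x - k * v\<^sub>1 x)"
    by (intro set_integral_diff set_integrable_mult_right u v)+
  have eqR: "(LINT t:{0..<x}|R.M. u\<^sub>2 t - k * v\<^sub>2 t) = (LINT t:{0..<x}|R.M. u\<^sub>2 t) - k * (LINT t:{0..<x}|R.M. v\<^sub>2 t)"
    by (subst set_integral_diff) (auto simp: u v)
  show "u\<^sub>1 x - k * v\<^sub>1 x = u\<^sub>1 0 - k * v\<^sub>1 0 + (LINT t:{0..<x}|R.M. u\<^sub>2 t - k * v\<^sub>2 t)"
    unfolding u(3) v(3) eqR by (simp add: algebra_simps)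
  have eqW: "(LINT t:{0..<x}|W.M. u\<^sub>1 t - k * v\<^sub>1 t) = (LINT t:{0..<x}|W.M. u\<^sub>1 t) - k * (LINT t:{0..<x}|W.M. v\<^sub>1 t)"
    by (subst set_integral_diff) (auto simp: u v)
  show "u\<^sub>2 x - k * v\<^sub>2 x = u\<^sub>2 0 - k * v\<^sub>2 0 - z * (LINT t:{0..<x}|W.M. u\<^sub>1 t - k * v\<^sub>1 t)"
    unfolding u(4) v(4) eqW by (simp add: algebra_simps)
qed

lemma wronskian:
  assumes "string_solution b W R z u\<^sub>1 u\<^sub>2" "string_solution b W R z v\<^sub>1 v\<^sub>2" "z \<noteq> 0" "x \<in> half_open b"
  shows "u\<^sub>1 x * v\<^sub>2 x - v\<^sub>1 x * u\<^sub>2 x = u\<^sub>1 0 * v\<^sub>2 0 - v\<^sub>1 0 * u\<^sub>2 0"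
  using lagrange_identity(3)[OF assms] lagrange_identity(3)[OF assms(2,1,3,4)]
  by (simp add: mult.commute)

text \<open>
  Exchanging the roles of \<open>W\<close> and \<open>R\<close> turns the solution with initial values \<open>(1, 0)\<close> into the one
  with initial values \<open>(0, 1)\<close>: if \<open>(v, w)\<close> solves the exchanged system then \<open>(- w / z, v)\<close> solves
  the given one.
\<close>

lemma exists_solution':
  assumes "z \<noteq> 0"
  shows "\<exists>s s\<^sub>1. string_solution b W R z s s\<^sub>1 \<and> s 0 = 0 \<and> s\<^sub>1 0 = 1"
proof -
  interpret S: string b R W by (rule string_swap)
  obtain v w where v: "string_solution b R W z v w" "v 0 = 1" "w 0 = 0"
    using S.exists_solution by blast
  define s where "s x = - w x / z" for x
  have "string_solution b W R z s v"
    unfolding string_solution_def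
  proof (intro ballI conjI)
    fix x assume x: "x \<in> half_open b"
    have h: "set_integrable W.M {0..<x} w" "set_integrable R.M {0..<x} v"
      "v x = 1 + (LINT t:{0..<x}|W.M. w t)" "w x = - z * (LINT t:{0..<x}|R.M. v t)"
      using v x unfolding string_solution_def by auto
    show "set_integrable R.M {0..<x} v" by (rule h)
    have e: "s t = (- 1 / z) * w t" for t by (simp add: s_def)
    show "set_integrable W.M {0..<x} s"
      unfolding e[abs_def] by (intro set_integrable_mult_right h)
    show "s x = s 0 + (LINT t:{0..<x}|R.M. v t)" using h(4) assms v by (simp add: s_def)
    show "v x = v 0 - z * (LINT t:{0..<x}|W.M. s t)"
      unfolding e set_integral_mult_right using h(3) assms v by simp
  qed
  moreover have "s 0 = 0" using v by (simp add: s_def)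
  ultimately show ?thesis using v by blast
qed

text \<open>
  The difference of two solutions with equal initial values has vanishing Wronskian with both
  fundamental solutions, and the Wronskian of these is \<open>1\<close>.
\<close>

lemma solution_unique:
  assumes u: "string_solution b W R z u\<^sub>1 u\<^sub>2" and v: "string_solution b W R z v\<^sub>1 v\<^sub>2" and z: "z \<noteq> 0"
    and init: "u\<^sub>1 0 = v\<^sub>1 0" "u\<^sub>2 0 = v\<^sub>2 0" and x: "x \<in> half_open b"
  shows "u\<^sub>1 x = v\<^sub>1 x"
proof -
  obtain c d where c: "string_solution b W R z c d" "c 0 = 1" "d 0 = 0"
    using exists_solution by blast
  obtain s e where s: "string_solution b W R z s e" "s 0 = 0" "e 0 = 1"
    using exists_solution'[OF z] by blast
  let ?\<delta> = "\<lambda>x. u\<^sub>1 x - 1 * v\<^sub>1 x" and ?\<epsilon> = "\<lambda>x. u\<^sub>2 x - 1 * v\<^sub>2 x"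
  have \<delta>: "string_solution b W R z ?\<delta> ?\<epsilon>" by (rule solution_diff[OF u v])
  have 1: "?\<delta> x * d x = c x * ?\<epsilon> x" using wronskian[OF \<delta> c(1) z x] init by simp
  have 2: "?\<delta> x * e x = s x * ?\<epsilon> x" using wronskian[OF \<delta> s(1) z x] init by simp
  have 3: "c x * e x - s x * d x = 1" using wronskian[OF c(1) s(1) z x] c s by simp
  have "?\<delta> x = ?\<delta> x * (c x * e x - s x * d x)" using 3 by simp
  also have "\<dots> = c x * (?\<delta> x * e x) - s x * (?\<delta> x * d x)" by (simp add: algebra_simps)
  also have "\<dots> = 0" unfolding 1 2 by (simp add: algebra_simps)
  finally show ?thesis by simp
qed

section \<open>The energy identity\<close>

lemma energy_identity:
  assumes u: "string_solution b W R z u\<^sub>1 u\<^sub>2" and z: "z \<noteq> 0" and x: "x \<in> half_open b"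
  shows "set_integrable W.M {0..<x} (\<lambda>t. (cmod (u\<^sub>1 t))\<^sup>2)"
    and "set_integrable R.M {0..<x} (\<lambda>t. (cmod (u\<^sub>2 t))\<^sup>2)"
    and "cnj (u\<^sub>1 x) * u\<^sub>2 x = cnj (u\<^sub>1 0) * u\<^sub>2 0
           + of_real (LINT t:{0..<x}|R.M. (cmod (u\<^sub>2 t))\<^sup>2)
           - z * of_real (LINT t:{0..<x}|W.M. (cmod (u\<^sub>1 t))\<^sup>2)"
proof -
  have e: "cnj w * w = complex_of_real ((cmod w)\<^sup>2)" for w
    using complex_norm_square[of w] by (simp add: mult.commute)
  note L = lagrange_identity[OF solution_cnj[OF u] u z x, unfolded e]
  show "set_integrable W.M {0..<x} (\<lambda>t. (cmod (u\<^sub>1 t))\<^sup>2)"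
    "set_integrable R.M {0..<x} (\<lambda>t. (cmod (u\<^sub>2 t))\<^sup>2)"
    using L(1,2) unfolding set_integrable_complex_of_real .
  show "cnj (u\<^sub>1 x) * u\<^sub>2 x = cnj (u\<^sub>1 0) * u\<^sub>2 0
           + of_real (LINT t:{0..<x}|R.M. (cmod (u\<^sub>2 t))\<^sup>2)
           - z * of_real (LINT t:{0..<x}|W.M. (cmod (u\<^sub>1 t))\<^sup>2)"
    using L(3) unfolding set_integral_complex_of_real by simp
qed

text \<open>
  On the imaginary axis \<open>cnj c * d\<close> has nonnegative real part by the energy identity, so all terms in
  the product rule for \<open>cnj c * c\<close> are nonnegative; both factors are primitives with respect to \<open>dR\<close>,
  and the atoms of \<open>dR\<close> contribute through the diagonal term.
\<close>

lemma neumann_solution_ge_1: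
  assumes c: "string_solution b W R (\<i> * of_real y) c d" "c 0 = 1" "d 0 = 0" and y: "0 < y"
    and x: "x \<in> half_open b"
  shows "1 \<le> cmod (c x)"
proof -
  interpret RR: stieltjes_pair b R R ..
  have z: "\<i> * of_real y \<noteq> 0" using y by simp
  have pos: "0 \<le> Re (cnj (c t) * d t)" if "t \<in> half_open b" for t
    using energy_identity(3)[OF c(1) z that] c set_lint_nonneg[of "{0..<t}" "\<lambda>t. (cmod (d t))\<^sup>2"]
    by simp
  have d: "set_integrable R.M {0..<x} d" using c(1) x unfolding string_solution_def by blast
  have c': "string_solution b W R (cnj (\<i> * of_real y)) (\<lambda>x. cnj (c x)) (\<lambda>x. cnj (d x))"
    by (rule solution_cnj[OF c(1)])
  have d': "set_integrable R.M {0..<x} (\<lambda>t. cnj (d t))"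
    using c' x unfolding string_solution_def by blast
  have U: "cnj (c t) = 1 + (LINT s:{0..<t}|R.M. cnj (d s))" if "t \<in> {0..x}" for t
    using c' c(2) half_open_Icc[OF that x] unfolding string_solution_def by (metis complex_cnj_one)
  have V: "c t = 1 + (LINT s:{0..<t}|R.M. d s)" if "t \<in> {0..x}" for t
    using c half_open_Icc[OF that x] unfolding string_solution_def by metis
  note P = RR.product_rule[OF x d' d U V]
  have n1: "0 \<le> Re (LINT t:{0..<x}|R.M. cnj (c t) * d t)"
    using pos half_open_Icc[OF _ x] by (intro Re_set_lint_nonneg P(1)) auto
  have n2: "0 \<le> Re (LINT t:{0..<x}|R.M. cnj (d t) * c t)"
  proof (intro Re_set_lint_nonneg P(2))
    fix t assume "t \<in> {0..<x}"
    then show "0 \<le> Re (cnj (d t) * c t)" using pos[of t] half_open_Icc[OF _ x, of t] by (simp add: algebra_simps)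
  qed
  have n3: "0 \<le> Re (LINT t:{0..<x}|R.M. measure R.M {t} *\<^sub>R (cnj (d t) * d t))"
  proof (intro Re_set_lint_nonneg P(3))
    fix t
    have "Re (measure R.M {t} *\<^sub>R (cnj (d t) * d t)) = measure R.M {t} * (cmod (d t))\<^sup>2"
      using cmod_power2[of "d t"] by (simp add: power2_eq_square)
    then show "0 \<le> Re (measure R.M {t} *\<^sub>R (cnj (d t) * d t))" by simp
  qed
  have "cnj (c x) * c x = 1 * 1 + (LINT t:{0..<x}|R.M. cnj (c t) * d t)
      + (LINT t:{0..<x}|R.M. cnj (d t) * c t)
      + (LINT t:{0..<x}|R.M. measure R.M {t} *\<^sub>R (cnj (d t) * d t))"
    by (rule P(4))
  then have "1 \<le> Re (cnj (c x) * c x)" using n1 n2 n3 by (simp only: plus_complex.sel) simp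
  also have "Re (cnj (c x) * c x) = (cmod (c x))\<^sup>2"
    using cmod_power2[of "c x"] by (simp add: power2_eq_square)
  finally show ?thesis using power2_le_imp_le[of 1 "cmod (c x)"] by simp
qed

lemma solution_increments:
  assumes u: "string_solution b W R (\<i> * of_real y) u\<^sub>1 u\<^sub>2" and y: "0 < y"
    and v: "0 \<le> v" "v \<le> x" and x: "x \<in> half_open b"
  shows "(cmod (u\<^sub>1 x - u\<^sub>1 v))\<^sup>2 \<le> (R x - R v) * (LINT t:{0..<x}|R.M. (cmod (u\<^sub>2 t))\<^sup>2)"
    and "(cmod (u\<^sub>2 x - u\<^sub>2 v))\<^sup>2 \<le> y\<^sup>2 * (W x - W v) * (LINT t:{0..<x}|W.M. (cmod (u\<^sub>1 t))\<^sup>2)"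
proof -
  have z: "\<i> * of_real y \<noteq> 0" using y by simp
  have vD: "v \<in> half_open b" using half_open_downward[OF v x] .
  have sub: "{v..<x} \<subseteq> {0..<x}" using v by auto
  have u2: "set_integrable R.M {0..<x} u\<^sub>2" and u1: "set_integrable W.M {0..<x} u\<^sub>1"
    using u x unfolding string_solution_def by blast+
  note e = energy_identity(1,2)[OF u z x]
  have i2: "set_integrable R.M {v..<x} u\<^sub>2" "set_integrable R.M {v..<x} (\<lambda>t. (cmod (u\<^sub>2 t))\<^sup>2)"
    using v x by (auto intro!: set_integrable_subset[OF u2 _ sub] set_integrable_subset[OF e(2) _ sub])
  have i1: "set_integrable W.M {v..<x} u\<^sub>1" "set_integrable W.M {v..<x} (\<lambda>t. (cmod (u\<^sub>1 t))\<^sup>2)"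
    using v x by (auto intro!: set_integrable_subset[OF u1 _ sub] set_integrable_subset[OF e(1) _ sub])
  have d1: "u\<^sub>1 x - u\<^sub>1 v = (LINT t:{v..<x}|R.M. u\<^sub>2 t)"
  proof -
    have "u\<^sub>1 x = u\<^sub>1 0 + (LINT t:{0..<x}|R.M. u\<^sub>2 t)" "u\<^sub>1 v = u\<^sub>1 0 + (LINT t:{0..<v}|R.M. u\<^sub>2 t)"
      using u x vD unfolding string_solution_def by blast+
    then show ?thesis using R.set_lint_split[OF v x u2] by simp
  qed
  have d2: "u\<^sub>2 x - u\<^sub>2 v = - (\<i> * of_real y) * (LINT t:{v..<x}|W.M. u\<^sub>1 t)"
  proof -
    have eqs: "u\<^sub>2 x = u\<^sub>2 0 - (\<i> * of_real y) * (LINT t:{0..<x}|W.M. u\<^sub>1 t)"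
      "u\<^sub>2 v = u\<^sub>2 0 - (\<i> * of_real y) * (LINT t:{0..<v}|W.M. u\<^sub>1 t)"
      using u x vD unfolding string_solution_def by blast+
    show ?thesis unfolding eqs W.set_lint_split[OF v x u1] by (simp add: algebra_simps)
  qed
  show "(cmod (u\<^sub>1 x - u\<^sub>1 v))\<^sup>2 \<le> (R x - R v) * (LINT t:{0..<x}|R.M. (cmod (u\<^sub>2 t))\<^sup>2)"
    unfolding d1 using R.mono'[OF v x]
    by (intro order_trans[OF R.set_lint_Cauchy_Schwarz[OF v x i2]] mult_left_mono
        R.set_lint_mono_interval v x e) auto
  have "(cmod (LINT t:{v..<x}|W.M. u\<^sub>1 t))\<^sup>2 \<le> (W x - W v) * (LINT t:{0..<x}|W.M. (cmod (u\<^sub>1 t))\<^sup>2)"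
    using W.mono'[OF v x]
    by (intro order_trans[OF W.set_lint_Cauchy_Schwarz[OF v x i1]] mult_left_mono
        W.set_lint_mono_interval v x e) auto
  then show "(cmod (u\<^sub>2 x - u\<^sub>2 v))\<^sup>2 \<le> y\<^sup>2 * (W x - W v) * (LINT t:{0..<x}|W.M. (cmod (u\<^sub>1 t))\<^sup>2)"
    unfolding d2 using y by (simp add: norm_mult power_mult_distrib mult.assoc mult_left_mono)
qed

section \<open>The Weyl solution\<close>

text \<open>
  The solution with initial values \<open>(- m, 1)\<close> at the spectral parameter \<open>\<i> y\<close>, together with the
  two energy bounds on \<open>[0, x)\<close> by the real and the imaginary part of \<open>m\<close>.  For fixed \<open>x\<close> this says
  that \<open>m\<close> lies in a region of Weyl disc type; if it holds for all \<open>x\<close>, then \<open>u\<^sub>1\<close> is the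
  square-integrable solution \<open>\<psi> = s - m c\<close>.
\<close>

definition weyl_solution :: "real \<Rightarrow> real \<Rightarrow> complex \<Rightarrow> (real \<Rightarrow> complex) \<Rightarrow> (real \<Rightarrow> complex) \<Rightarrow> bool" where
  "weyl_solution y x m u\<^sub>1 u\<^sub>2 \<longleftrightarrow>
     string_solution b W R (\<i> * of_real y) u\<^sub>1 u\<^sub>2 \<and> u\<^sub>1 0 = - m \<and> u\<^sub>2 0 = 1 \<and>
     (LINT t:{0..<x}|R.M. (cmod (u\<^sub>2 t))\<^sup>2) \<le> Re m \<and>
     y * (LINT t:{0..<x}|W.M. (cmod (u\<^sub>1 t))\<^sup>2) \<le> Im m"

lemma weyl_solution_mono:
  assumes w: "weyl_solution y x m u\<^sub>1 u\<^sub>2" and y: "0 < y" and v: "0 \<le> v" "v \<le> x" and x: "x \<in> half_open b"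
  shows "weyl_solution y v m u\<^sub>1 u\<^sub>2"
proof -
  have u: "string_solution b W R (\<i> * of_real y) u\<^sub>1 u\<^sub>2" using w by (simp add: weyl_solution_def)
  have z: "\<i> * of_real y \<noteq> 0" using y by simp
  note e = energy_identity(1,2)[OF u z x]
  have "(LINT t:{0..<v}|R.M. (cmod (u\<^sub>2 t))\<^sup>2) \<le> (LINT t:{0..<x}|R.M. (cmod (u\<^sub>2 t))\<^sup>2)"
    by (intro R.set_lint_mono_interval v x e) auto
  moreover have "y * (LINT t:{0..<v}|W.M. (cmod (u\<^sub>1 t))\<^sup>2) \<le> y * (LINT t:{0..<x}|W.M. (cmod (u\<^sub>1 t))\<^sup>2)"
    using y by (intro mult_left_mono W.set_lint_mono_interval v x e) auto
  ultimately show ?thesis using w by (auto simp: weyl_solution_def)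
qed

text \<open>
  If \<open>4 R(x) Re m < \<bar>m\<bar>\<^sup>2\<close>, then by Cauchy--Schwarz \<open>u\<^sub>1\<close> stays within \<open>\<bar>m\<bar> / 2\<close> of its initial value
  \<open>- m\<close> on \<open>[0, x)\<close>, and the energy bound for \<open>u\<^sub>1\<close> then forces \<open>y W(x) \<bar>m\<bar> \<le> 4\<close>.
\<close>

lemma weyl_upper_bound:
  assumes w: "weyl_solution y x m u\<^sub>1 u\<^sub>2" and y: "0 < y" and x: "x \<in> half_open b"
    and big: "4 < y * W x * cmod m"
  shows "(cmod m)\<^sup>2 \<le> 4 * R x * Re m"
proof (rule ccontr)
  assume "\<not> (cmod m)\<^sup>2 \<le> 4 * R x * Re m"
  then have less: "4 * R x * Re m < (cmod m)\<^sup>2" by simp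
  have x0: "0 \<le> x" using x by (auto simp: half_open_def)
  have u: "string_solution b W R (\<i> * of_real y) u\<^sub>1 u\<^sub>2" "u\<^sub>1 0 = - m"
    using w by (auto simp: weyl_solution_def)
  have z: "\<i> * of_real y \<noteq> 0" using y by simp
  have lower: "cmod m / 2 \<le> cmod (u\<^sub>1 t)" if t: "t \<in> {0..<x}" for t
  proof -
    have tD: "t \<in> half_open b" using half_open_Icc[OF _ x] t by auto
    have wt: "weyl_solution y t m u\<^sub>1 u\<^sub>2" using weyl_solution_mono[OF w y _ _ x] t by auto
    have le: "(LINT s:{0..<t}|R.M. (cmod (u\<^sub>2 s))\<^sup>2) \<le> Re m" using wt by (simp add: weyl_solution_def)
    have nn: "0 \<le> (LINT s:{0..<t}|R.M. (cmod (u\<^sub>2 s))\<^sup>2)" by (intro set_lint_nonneg) auto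
    have "(cmod (u\<^sub>1 t + m))\<^sup>2 \<le> R t * (LINT s:{0..<t}|R.M. (cmod (u\<^sub>2 s))\<^sup>2)"
      using solution_increments(1)[OF u(1) y _ _ tD, of 0] t u(2) by (simp add: R.F0)
    also have "\<dots> \<le> R x * Re m"
      using R.nonneg[OF x] R.mono'[of t x] t x nn le by (intro mult_mono) auto
    also have "\<dots> < (cmod m / 2)\<^sup>2" using less by (simp add: power_divide)
    finally have "cmod (u\<^sub>1 t + m) < cmod m / 2" by (rule power2_less_imp_less) simp
    then show ?thesis using norm_triangle_ineq4[of "u\<^sub>1 t + m" "u\<^sub>1 t"] by simp
  qed
  have "W x * (cmod m / 2)\<^sup>2 = (LINT t:{0..<x}|W.M. (cmod m / 2)\<^sup>2)"
    using x x0 by (subst W.set_lint_const) (auto simp: W.F0)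
  also have "\<dots> \<le> (LINT t:{0..<x}|W.M. (cmod (u\<^sub>1 t))\<^sup>2)"
    by (intro set_integral_mono W.set_integrable_const x energy_identity(1)[OF u(1) z x] power_mono lower) auto
  finally have "y * (W x * (cmod m / 2)\<^sup>2) \<le> y * (LINT t:{0..<x}|W.M. (cmod (u\<^sub>1 t))\<^sup>2)"
    using y by (intro mult_left_mono) auto
  also have "\<dots> \<le> Im m" using w by (simp add: weyl_solution_def)
  also have "\<dots> \<le> cmod m" using abs_Im_le_cmod[of m] by simp
  finally have "y * W x * cmod m * cmod m \<le> 4 * cmod m"
    by (simp add: power2_eq_square)
  moreover have "cmod m > 0" using big by (cases "m = 0") auto
  ultimately show False using big by simp
qed

text \<open>
  If \<open>y W(x) \<bar>m\<bar>\<close> is small, then by Cauchy--Schwarz \<open>u\<^sub>2\<close> stays near its initial value \<open>1\<close> on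
  \<open>[0, x)\<close>, which makes its energy at least \<open>R(x) / 4\<close>.
\<close>

lemma weyl_lower_bound:
  assumes w: "weyl_solution y x m u\<^sub>1 u\<^sub>2" and y: "0 < y" and x: "x \<in> half_open b"
    and small: "4 * y * W x * cmod m \<le> 1"
  shows "R x \<le> 4 * Re m"
proof -
  have x0: "0 \<le> x" using x by (auto simp: half_open_def)
  have u: "string_solution b W R (\<i> * of_real y) u\<^sub>1 u\<^sub>2" "u\<^sub>2 0 = 1"
    using w by (auto simp: weyl_solution_def)
  have z: "\<i> * of_real y \<noteq> 0" using y by simp
  have lower: "1 / 2 \<le> cmod (u\<^sub>2 t)" if t: "t \<in> {0..<x}" for t
  proof -
    have tD: "t \<in> half_open b" using half_open_Icc[OF _ x] t by auto
    have wt: "weyl_solution y t m u\<^sub>1 u\<^sub>2" using weyl_solution_mono[OF w y _ _ x] t by auto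
    have le: "y * (LINT s:{0..<t}|W.M. (cmod (u\<^sub>1 s))\<^sup>2) \<le> Im m" using wt by (simp add: weyl_solution_def)
    have nn: "0 \<le> (LINT s:{0..<t}|W.M. (cmod (u\<^sub>1 s))\<^sup>2)" by (intro set_lint_nonneg) auto
    have "(cmod (u\<^sub>2 t - 1))\<^sup>2 \<le> (y * W t) * (y * (LINT s:{0..<t}|W.M. (cmod (u\<^sub>1 s))\<^sup>2))"
      using solution_increments(2)[OF u(1) y _ _ tD, of 0] t u(2)
      by (simp add: W.F0 power2_eq_square mult_ac)
    also have "\<dots> \<le> (y * W x) * cmod m"
      using W.nonneg[OF x] W.nonneg[OF tD] W.mono'[of t x] t x nn le y abs_Im_le_cmod[of m] by (intro mult_mono) auto
    also have "\<dots> \<le> (1 / 2)\<^sup>2" using small by (simp add: power_divide)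
    finally have "cmod (u\<^sub>2 t - 1) \<le> 1 / 2" by (rule power2_le_imp_le) simp
    then show ?thesis using norm_triangle_ineq4[of "u\<^sub>2 t" "u\<^sub>2 t - 1"] by simp
  qed
  have "R x * (1 / 2)\<^sup>2 = (LINT t:{0..<x}|R.M. (1 / 2)\<^sup>2)"
    using x x0 by (subst R.set_lint_const) (auto simp: R.F0)
  also have "\<dots> \<le> (LINT t:{0..<x}|R.M. (cmod (u\<^sub>2 t))\<^sup>2)"
    by (intro set_integral_mono R.set_integrable_const x energy_identity(2)[OF u(1) z x] power_mono lower) auto
  also have "\<dots> \<le> Re m" using w by (simp add: weyl_solution_def)
  finally show ?thesis by (simp add: power_divide)
qed

text \<open>
  For the solution whose first component vanishes at \<open>x\<close>, the energy identity at \<open>x\<close> turns both energy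
  bounds into equalities.
\<close>

lemma exists_weyl_truncated:
  assumes y: "0 < y" and x: "x \<in> half_open b"
    and c: "string_solution b W R (\<i> * of_real y) c d" "c 0 = 1" "d 0 = 0"
    and s: "string_solution b W R (\<i> * of_real y) s e" "s 0 = 0" "e 0 = 1"
  shows "weyl_solution y x (s x / c x) (\<lambda>t. s t - s x / c x * c t) (\<lambda>t. e t - s x / c x * d t)"
proof -
  define m where "m = s x / c x"
  have z: "\<i> * of_real y \<noteq> 0" using y by simp
  have "c x \<noteq> 0" using neumann_solution_ge_1[OF c y x] by auto
  then have zero: "s x - m * c x = 0" by (simp add: m_def)
  have sol: "string_solution b W R (\<i> * of_real y) (\<lambda>t. s t - m * c t) (\<lambda>t. e t - m * d t)"
    by (rule solution_diff[OF s(1) c(1)])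
  define A where "A = (LINT t:{0..<x}|R.M. (cmod (e t - m * d t))\<^sup>2)"
  define B where "B = (LINT t:{0..<x}|W.M. (cmod (s t - m * c t))\<^sup>2)"
  have "of_real A - cnj m = (\<i> * of_real y) * of_real B"
    using energy_identity(3)[OF sol z x] zero c s by (simp add: A_def B_def)
  then have "Re m = A" "Im m = y * B" by (auto simp: complex_eq_iff)
  then show ?thesis using sol c s
    unfolding m_def[symmetric] weyl_solution_def by (simp add: A_def B_def)
qed

text \<open>
  The truncated values \<open>s(x) / c(x)\<close> stay bounded as \<open>x \<rightarrow> b\<close> by the upper bound at a fixed point.
  Any limit point inherits the energy bounds on every \<open>[0, x)\<close>; convergence of the whole
  family is not needed.
\<close>

lemma exists_weyl_solution:
  assumes y: "0 < y"
    and c: "string_solution b W R (\<i> * of_real y) c d" "c 0 = 1" "d 0 = 0"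
    and s: "string_solution b W R (\<i> * of_real y) s e" "s 0 = 0" "e 0 = 1"
  shows "\<exists>m. \<forall>x\<in>half_open b. weyl_solution y x m (\<lambda>t. s t - m * c t) (\<lambda>t. e t - m * d t)"
proof -
  have z: "\<i> * of_real y \<noteq> 0" using y by simp
  obtain X where X: "incseq X" "\<And>n. X n \<in> half_open b"
    "\<And>x. x \<in> half_open b \<Longrightarrow> eventually (\<lambda>n. x < X n) sequentially" using W.exhausting_sequence by blast
  define m where "m n = s (X n) / c (X n)" for n
  have weyl: "weyl_solution y x (m n) (\<lambda>t. s t - m n * c t) (\<lambda>t. e t - m n * d t)"
    if "x \<in> half_open b" "x \<le> X n" for x n
    using weyl_solution_mono[OF exists_weyl_truncated[OF y X(2) c s] y _ that(2) X(2)] that(1)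
    by (auto simp: m_def half_open_def)
  obtain x0 where x0: "x0 \<in> half_open b" "W x0 > 0" using W.unbounded by blast
  obtain N where N: "\<And>n. n \<ge> N \<Longrightarrow> x0 < X n"
    using X(3)[OF x0(1)] unfolding eventually_sequentially by blast
  have bound: "cmod (m n) \<le> max (4 / (y * W x0)) (4 * R x0)" if "n \<ge> N" for n
  proof (cases "4 < y * W x0 * cmod (m n)")
    case True
    have "(cmod (m n))\<^sup>2 \<le> 4 * R x0 * Re (m n)"
      using weyl_upper_bound[OF weyl y x0(1) True] x0 N[OF that] by simp
    also have "\<dots> \<le> 4 * R x0 * cmod (m n)"
      using R.nonneg[OF x0(1)] by (intro mult_left_mono complex_Re_le_cmod) auto
    finally have "cmod (m n) * cmod (m n) \<le> 4 * R x0 * cmod (m n)" by (simp add: power2_eq_square)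
    moreover have "cmod (m n) > 0" using True by (cases "m n = 0") auto
    ultimately show ?thesis by simp
  next
    case False
    then have "cmod (m n) \<le> 4 / (y * W x0)" using y x0 by (simp add: field_simps)
    then show ?thesis by simp
  qed
  have "bounded (range (\<lambda>n. m (n + N)))"
    unfolding bounded_iff using bound by (intro exI[of _ "max (4 / (y * W x0)) (4 * R x0)"]) auto
  from bounded_imp_convergent_subsequence[OF this] obtain l r where
    r: "strict_mono (r :: nat \<Rightarrow> nat)" and l0: "((\<lambda>n. m (n + N)) \<circ> r) \<longlonglongrightarrow> l" by blast
  define k where "k n = r n + N" for n
  have l: "(\<lambda>n. m (k n)) \<longlonglongrightarrow> l" using l0 by (simp add: k_def o_def)
  have "filterlim k at_top sequentially"
    unfolding k_def using filterlim_subseq[OF r] by (rule filterlim_at_top_mono) auto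
  then have ev: "eventually (\<lambda>n. x < X (k n)) sequentially" if "x \<in> half_open b" for x
    using X(3)[OF that] unfolding filterlim_iff by blast
  have "weyl_solution y x l (\<lambda>t. s t - l * c t) (\<lambda>t. e t - l * d t)" if x: "x \<in> half_open b" for x
    unfolding weyl_solution_def
  proof (intro conjI)
    show "string_solution b W R (\<i> * of_real y) (\<lambda>t. s t - l * c t) (\<lambda>t. e t - l * d t)"
      by (rule solution_diff[OF s(1) c(1)])
    show "s 0 - l * c 0 = - l" "e 0 - l * d 0 = 1" using c s by auto
    have i: "set_integrable R.M {0..<x} d" "set_integrable R.M {0..<x} e"
      "set_integrable W.M {0..<x} c" "set_integrable W.M {0..<x} s"
      using c(1) s(1) x unfolding string_solution_def by blast+
    note E = energy_identity(1,2)[OF c(1) z x] energy_identity(1,2)[OF s(1) z x]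
    have ev': "eventually (\<lambda>n. weyl_solution y x (m (k n)) (\<lambda>t. s t - m (k n) * c t)
        (\<lambda>t. e t - m (k n) * d t)) sequentially"
      using ev[OF x] by eventually_elim (use weyl x in auto)
    show "(LINT t:{0..<x}|R.M. (cmod (e t - l * d t))\<^sup>2) \<le> Re l"
    proof (rule tendsto_le[OF _ tendsto_Re[OF l] tendsto_set_lint_affine[OF i(2) E(4) i(1) E(2) l]])
      show "eventually (\<lambda>n. (LINT t:{0..<x}|R.M. (cmod (e t - m (k n) * d t))\<^sup>2) \<le> Re (m (k n))) sequentially"
        using ev' by eventually_elim (simp add: weyl_solution_def)
    qed simp
    show "y * (LINT t:{0..<x}|W.M. (cmod (s t - l * c t))\<^sup>2) \<le> Im l"
    proof (rule tendsto_le[OF _ tendsto_Im[OF l]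
          tendsto_mult_left[OF tendsto_set_lint_affine[OF i(4) E(3) i(3) E(1) l]]])
      show "eventually (\<lambda>n. y * (LINT t:{0..<x}|W.M. (cmod (s t - m (k n) * c t))\<^sup>2) \<le> Im (m (k n))) sequentially"
        using ev' by eventually_elim (simp add: weyl_solution_def)
    qed simp
  qed
  then show ?thesis by blast
qed

lemma open_part_sets: "{x. 0 < x \<and> ereal x < b} \<in> sets W.M"
proof -
  have "{x \<in> space W.M. 0 < x} \<in> sets W.M" by measurable
  moreover have "{x \<in> space W.M. 0 < x} = {x. 0 < x \<and> ereal x < b}" by (auto simp: half_open_def)
  ultimately show ?thesis by simp
qed

lemma weyl_solution_square_integrable:
  assumes y: "0 < y" and w: "\<And>x. x \<in> half_open b \<Longrightarrow> weyl_solution y x m u\<^sub>1 u\<^sub>2"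
  shows "square_integrable b W u\<^sub>1"
proof -
  have z: "\<i> * of_real y \<noteq> 0" using y by simp
  have u: "string_solution b W R (\<i> * of_real y) u\<^sub>1 u\<^sub>2"
    using w[OF W.zero_mem] by (simp add: weyl_solution_def)
  obtain X where X: "incseq X" "\<And>n. X n \<in> half_open b"
    "\<And>x. x \<in> half_open b \<Longrightarrow> eventually (\<lambda>n. x < X n) sequentially" using W.exhausting_sequence by blast
  have sub: "{x. 0 < x \<and> ereal x < b} \<subseteq> half_open b" by (auto simp: half_open_def)
  have lim: "(\<lambda>n. indicator {0..<X n} t *\<^sub>R g t) \<longlonglongrightarrow> indicator (half_open b) t *\<^sub>R g t"
    if "t \<in> half_open b" for t and g :: "real \<Rightarrow> 'v :: real_normed_vector"
  proof (rule tendsto_eventually)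
    show "\<forall>\<^sub>F n in sequentially. indicator {0..<X n} t *\<^sub>R g t = indicator (half_open b) t *\<^sub>R g t"
      using X(3)[OF that] by eventually_elim (use that in \<open>auto simp: half_open_def\<close>)
  qed
  have "u\<^sub>1 \<in> borel_measurable W.M"
  proof -
    have "(\<lambda>t. indicator (half_open b) t *\<^sub>R u\<^sub>1 t) \<in> borel_measurable W.M"
    proof (rule borel_measurable_LIMSEQ_metric)
      show "(\<lambda>t. indicator {0..<X n} t *\<^sub>R u\<^sub>1 t) \<in> borel_measurable W.M" for n
        using u X(2)[of n] borel_measurable_integrable[of W.M]
        unfolding string_solution_def set_integrable_def by blast
      show "(\<lambda>n. indicator {0..<X n} t *\<^sub>R u\<^sub>1 t) \<longlonglongrightarrow> indicator (half_open b) t *\<^sub>R u\<^sub>1 t"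
        if "t \<in> space W.M" for t using lim that by simp
    qed
    then show ?thesis by (subst (asm) measurable_cong[where g = u\<^sub>1]) auto
  qed
  then have meas: "set_borel_measurable W.M {x. 0 < x \<and> ereal x < b} u\<^sub>1"
    unfolding set_borel_measurable_def
    by (intro borel_measurable_scaleR borel_measurable_indicator open_part_sets)
  let ?I = "\<lambda>n. LINT t:{0..<X n}|W.M. (cmod (u\<^sub>1 t))\<^sup>2"
  have I: "set_integrable W.M {0..<X n} (\<lambda>t. (cmod (u\<^sub>1 t))\<^sup>2)" for n
    by (rule energy_identity(1)[OF u z X(2)])
  have "incseq ?I"
  proof (rule incseq_SucI)
    fix n show "?I n \<le> ?I (Suc n)"
      using X(1) X(2)[of n] by (intro W.set_lint_mono_interval X(2) I) (auto simp: incseq_Suc_iff half_open_def)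
  qed
  moreover have "?I n \<le> Im m / y" for n
    using w[OF X(2), of n] y by (simp add: weyl_solution_def field_simps)
  ultimately obtain L where L: "?I \<longlonglongrightarrow> L" using incseq_convergent by metis
  have "integrable W.M (\<lambda>t. indicator (half_open b) t *\<^sub>R (cmod (u\<^sub>1 t))\<^sup>2)"
  proof (rule integrable_monotone_convergence)
    show "integrable W.M (\<lambda>t. indicator {0..<X n} t *\<^sub>R (cmod (u\<^sub>1 t))\<^sup>2)" for n
      using I unfolding set_integrable_def .
    show "AE t in W.M. mono (\<lambda>n. indicator {0..<X n} t *\<^sub>R (cmod (u\<^sub>1 t))\<^sup>2)"
      using X(1) by (intro AE_I2 monoI) (auto simp: indicator_def dest: monoD order_less_le_trans)
    show "AE t in W.M. (\<lambda>n. indicator {0..<X n} t *\<^sub>R (cmod (u\<^sub>1 t))\<^sup>2)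
        \<longlonglongrightarrow> indicator (half_open b) t *\<^sub>R (cmod (u\<^sub>1 t))\<^sup>2"
      by (intro AE_I2 lim) simp
    show "(\<lambda>n. LINT t|W.M. indicator {0..<X n} t *\<^sub>R (cmod (u\<^sub>1 t))\<^sup>2) \<longlonglongrightarrow> L"
      using L unfolding set_lebesgue_integral_def .
    show "(\<lambda>t. indicator (half_open b) t *\<^sub>R (cmod (u\<^sub>1 t))\<^sup>2) \<in> borel_measurable W.M"
      using \<open>u\<^sub>1 \<in> borel_measurable W.M\<close> sets.top[of W.M]
      unfolding space_stieltjes_measure
      by (intro borel_measurable_scaleR borel_measurable_indicator borel_measurable_power
          measurable_compose[OF _ borel_measurable_norm])
  qed
  then have "set_integrable W.M (half_open b) (\<lambda>t. (cmod (u\<^sub>1 t))\<^sup>2)" unfolding set_integrable_def .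
  then show ?thesis
    using meas set_integrable_subset[OF _ open_part_sets sub] unfolding square_integrable_def by blast
qed

text \<open>
  The limit point case: as \<open>\<bar>c\<bar> \<ge> 1\<close> and \<open>W\<close> is unbounded, \<open>c\<close> is not square-integrable, even with the
  possible atom of \<open>dW\<close> at \<open>0\<close> left out.
\<close>

lemma neumann_solution_not_square_integrable:
  assumes c: "string_solution b W R (\<i> * of_real y) c d" "c 0 = 1" "d 0 = 0" and y: "0 < y"
  shows "\<not> set_integrable W.M {x. 0 < x \<and> ereal x < b} (\<lambda>x. (cmod (c x))\<^sup>2)"
proof
  let ?A = "{x. 0 < x \<and> ereal x < b}"
  assume A: "set_integrable W.M ?A (\<lambda>x. (cmod (c x))\<^sup>2)"
  obtain x0 where x0: "x0 > 0" "x0 \<in> half_open b" using W.exists_greater[OF W.zero_mem] by auto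
  define K where "K = (LINT t:?A|W.M. (cmod (c t))\<^sup>2)"
  have "K \<ge> 0" unfolding K_def by (intro set_lint_nonneg) auto
  obtain x where x: "x \<in> half_open b" "W x0 + K < W x" using W.unbounded by blast
  have le: "x0 \<le> x" using x W.mono'[of x x0] x0 \<open>K \<ge> 0\<close> by (force simp: half_open_def)
  have sub: "{x0..<x} \<subseteq> ?A" using x0 half_open_Icc[OF _ x(1)] by (force simp: half_open_def)
  have S: "set_integrable W.M {x0..<x} (\<lambda>x. (cmod (c x))\<^sup>2)"
    using x0 x(1) by (intro set_integrable_subset[OF A _ sub]) auto
  have "W x - W x0 = (LINT t:{x0..<x}|W.M. 1)"
    using x0 x le by (subst W.set_lint_const) auto
  also have "\<dots> \<le> (LINT t:{x0..<x}|W.M. (cmod (c t))\<^sup>2)"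
  proof (intro set_integral_mono W.set_integrable_const S x)
    fix t assume "t \<in> {x0..<x}"
    then have "1 \<le> cmod (c t)"
      using x0 half_open_Icc[OF _ x(1), of t] by (intro neumann_solution_ge_1[OF c y]) auto
    then show "1 \<le> (cmod (c t))\<^sup>2" by simp
  qed (use x0 in simp)
  also have "\<dots> \<le> K"
    unfolding K_def set_lebesgue_integral_def
    by (intro integral_mono S[unfolded set_integrable_def] A[unfolded set_integrable_def])
      (use sub in \<open>auto simp: indicator_def\<close>)
  finally show False using x by simp
qed

theorem neumann_m_weyl_solution:
  assumes y: "0 < y"
  shows "\<exists>u\<^sub>1 u\<^sub>2. \<forall>x\<in>half_open b. weyl_solution y x (neumann_m b W R (\<i> * of_real y)) u\<^sub>1 u\<^sub>2"
proof -
  let ?z = "\<i> * complex_of_real y"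
  have z: "?z \<noteq> 0" using y by simp
  obtain c d where c: "string_solution b W R ?z c d" "c 0 = 1" "d 0 = 0"
    using exists_solution by blast
  obtain s e where s: "string_solution b W R ?z s e" "s 0 = 0" "e 0 = 1"
    using exists_solution'[OF z] by blast
  obtain m where m: "\<And>x. x \<in> half_open b \<Longrightarrow> weyl_solution y x m (\<lambda>t. s t - m * c t) (\<lambda>t. e t - m * d t)"
    using exists_weyl_solution[OF y c s] by blast
  have sq: "square_integrable b W (\<lambda>t. s t - m * c t)"
    by (rule weyl_solution_square_integrable[OF y m])
  have "neumann_m b W R ?z = m"
    unfolding neumann_m_def
  proof (rule the_equality)
    show "\<exists>c c\<^sub>1 s s\<^sub>1. string_solution b W R ?z c c\<^sub>1 \<and> c 0 = 1 \<and> c\<^sub>1 0 = 0 \<and>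
        string_solution b W R ?z s s\<^sub>1 \<and> s 0 = 0 \<and> s\<^sub>1 0 = 1 \<and> square_integrable b W (\<lambda>x. s x - m * c x)"
      using c s sq by blast
  next
    fix m' assume "\<exists>c c\<^sub>1 s s\<^sub>1. string_solution b W R ?z c c\<^sub>1 \<and> c 0 = 1 \<and> c\<^sub>1 0 = 0 \<and>
        string_solution b W R ?z s s\<^sub>1 \<and> s 0 = 0 \<and> s\<^sub>1 0 = 1 \<and> square_integrable b W (\<lambda>x. s x - m' * c x)"
    then obtain c' d' s' e' where c': "string_solution b W R ?z c' d'" "c' 0 = 1" "d' 0 = 0"
      and s': "string_solution b W R ?z s' e'" "s' 0 = 0" "e' 0 = 1"
      and sq': "square_integrable b W (\<lambda>x. s' x - m' * c' x)" by blast
    have same: "c' x = c x" "s' x = s x" if "x \<in> half_open b" for x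
      using solution_unique[OF c'(1) c(1) z] solution_unique[OF s'(1) s(1) z] c c' s s' that by auto
    let ?A = "{x. 0 < x \<and> ereal x < b}"
    let ?f = "\<lambda>x. s x - m * c x" and ?g = "\<lambda>x. s' x - m' * c' x"
    show "m' = m"
    proof (rule ccontr)
      assume ne: "m' \<noteq> m"
      \<comment> \<open>The difference of two square-integrable candidates is a nonzero multiple of \<open>c\<close>.\<close>
      have diff: "(m' - m) * c x = ?f x - ?g x" if "x \<in> ?A" for x
        using same[of x] that by (simp add: half_open_def algebra_simps)
      have "set_integrable W.M ?A (\<lambda>x. (cmod (?f x - ?g x))\<^sup>2)"
      proof (rule set_integrable_bound[OF _ _ AE_I2])
        show "set_integrable W.M ?A (\<lambda>x. 2 * (cmod (?f x))\<^sup>2 + 2 * (cmod (?g x))\<^sup>2)"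
          using sq sq' unfolding square_integrable_def
          by (intro set_integral_add set_integrable_mult_right) auto
        have "(\<lambda>x. (cmod (indicator ?A x *\<^sub>R ?f x - indicator ?A x *\<^sub>R ?g x))\<^sup>2) \<in> borel_measurable W.M"
          using sq sq' unfolding square_integrable_def set_borel_measurable_def
          by (intro borel_measurable_power borel_measurable_norm borel_measurable_diff) auto
        moreover have "(cmod (indicator ?A x *\<^sub>R ?f x - indicator ?A x *\<^sub>R ?g x))\<^sup>2
            = indicator ?A x *\<^sub>R (cmod (?f x - ?g x))\<^sup>2" for x
          by (simp add: indicator_def)
        ultimately show "set_borel_measurable W.M ?A (\<lambda>x. (cmod (?f x - ?g x))\<^sup>2)"
          unfolding set_borel_measurable_def by (simp only:)
        have "(cmod (?f x - ?g x))\<^sup>2 \<le> 2 * (cmod (?f x))\<^sup>2 + 2 * (cmod (?g x))\<^sup>2" for x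
        proof -
          have "(cmod (?f x - ?g x))\<^sup>2 \<le> (cmod (?f x) + cmod (?g x))\<^sup>2"
            by (intro power_mono norm_triangle_ineq4) auto
          also have "\<dots> \<le> 2 * (cmod (?f x))\<^sup>2 + 2 * (cmod (?g x))\<^sup>2"
            using zero_le_power2[of "cmod (?f x) - cmod (?g x)"] by (simp add: power2_sum power2_diff)
          finally show ?thesis .
        qed
        then show "x \<in> ?A \<longrightarrow> norm ((cmod (?f x - ?g x))\<^sup>2) \<le> norm (2 * (cmod (?f x))\<^sup>2 + 2 * (cmod (?g x))\<^sup>2)" for x
          by simp
      qed
      then have "set_integrable W.M ?A (\<lambda>x. (cmod (m' - m))\<^sup>2 * (cmod (c x))\<^sup>2)"
        by (subst set_integrable_cong[OF refl refl])
          (auto simp: diff[symmetric] norm_mult power_mult_distrib)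
      then have "set_integrable W.M ?A (\<lambda>x. (cmod (c x))\<^sup>2)" using ne by simp
      then show False using neumann_solution_not_square_integrable[OF c y] by simp
    qed
  qed
  then show ?thesis using m by blast
qed

end

section \<open>Positively increasing functions and the generalized inverse\<close>

lemma positively_increasing_imp_growth:
  fixes f :: "real \<Rightarrow> real"
  assumes f: "positively_increasing_at_top f" and lim: "filterlim f at_top at_top" and N: "0 < N"
  shows "\<exists>C>0. \<exists>X\<^sub>0>0. \<forall>X\<ge>X\<^sub>0. N * f X \<le> f (C * X)"
proof -
  have mono: "mono_on {0<..} f" using f by (simp add: positively_increasing_at_top_def)
  obtain t where t: "0 < t" "t < 1" and ne: "Limsup at_top (\<lambda>x. ereal (f (x * t) / f x)) \<noteq> 1"
    using f by (auto simp: positively_increasing_at_top_def)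
  have pos: "eventually (\<lambda>x. 0 < f x \<and> 0 < x) at_top"
    using lim eventually_gt_at_top[of 0] unfolding filterlim_at_top_dense by (auto intro: eventually_conj)
  have "Limsup at_top (\<lambda>x. ereal (f (x * t) / f x)) \<le> 1"
  proof (rule Limsup_bounded)
    show "\<forall>\<^sub>F x in at_top. ereal (f (x * t) / f x) \<le> 1"
      using pos
    proof eventually_elim
      case (elim x)
      then have "f (x * t) \<le> f x" using t by (intro mono_onD[OF mono]) auto
      then show ?case using elim by simp
    qed
  qed
  then have "Limsup at_top (\<lambda>x. ereal (f (x * t) / f x)) < 1" using ne by simp
  then obtain q' where q': "Limsup at_top (\<lambda>x. ereal (f (x * t) / f x)) < ereal q'" "ereal q' < 1"
    using ereal_dense2 by blast
  define q where "q = max q' (1/2)"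
  have q: "0 < q" "q < 1" using q'(2) by (auto simp: q_def)
  have "\<forall>\<^sub>F x in at_top. f (x * t) \<le> q * f x"
    using Limsup_lessD[OF q'(1)] pos
  proof eventually_elim
    case (elim x)
    then have "f (x * t) / f x \<le> q" by (simp add: q_def)
    then show ?case using elim by (simp add: field_simps)
  qed
  then obtain X\<^sub>1 where X\<^sub>1: "\<And>x. x \<ge> X\<^sub>1 \<Longrightarrow> f (x * t) \<le> q * f x"
    unfolding eventually_at_top_linorder by blast
  have iter: "f X \<le> q ^ n * f (X / t ^ n)" if X: "X \<ge> max X\<^sub>1 1" for X n
  proof (induction n)
    case (Suc n)
    have tn: "t ^ Suc n \<le> 1" "0 < t ^ Suc n" using t by (auto intro!: power_le_one simp del: power_Suc)
    then have "X \<le> X / t ^ Suc n" using X by (simp add: field_simps del: power_Suc)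
    then have "f (X / t ^ Suc n * t) \<le> q * f (X / t ^ Suc n)" using X by (intro X\<^sub>1) linarith
    then have "q ^ n * f (X / t ^ n) \<le> q ^ n * (q * f (X / t ^ Suc n))"
      using t q by (intro mult_left_mono) auto
    then show ?case using Suc by (simp add: mult_ac)
  qed simp
  obtain n where n: "q ^ n < 1 / N" using real_arch_pow_inv[of "1 / N" q] q N by auto
  obtain X\<^sub>2 where X\<^sub>2: "\<And>x. x \<ge> X\<^sub>2 \<Longrightarrow> 0 < f x"
    using pos unfolding eventually_at_top_linorder by blast
  have "N * f X \<le> f (1 / t ^ n * X)" if X: "X \<ge> Max {X\<^sub>1, 1, X\<^sub>2}" for X
  proof -
    have "X \<le> X / t ^ n" using X t by (simp add: field_simps power_le_one mult_left_le)
    then have "0 < f (X / t ^ n)" using X by (intro X\<^sub>2) auto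
    then have "q ^ n * f (X / t ^ n) \<le> 1 / N * f (X / t ^ n)" using n by (intro mult_right_mono) auto
    then have "f X \<le> 1 / N * f (X / t ^ n)" using iter[of X n] X by auto
    then show ?thesis using N by (simp add: field_simps)
  qed
  then show ?thesis using t by (intro exI[of _ "1 / t ^ n"] exI[of _ "Max {X\<^sub>1, 1, X\<^sub>2}"] conjI) auto
qed

lemma not_positively_increasing_imp_flat:
  fixes f :: "real \<Rightarrow> real"
  assumes mono: "mono_on {0<..} f" and lim: "filterlim f at_top at_top"
    and not: "\<not> positively_increasing_at_top f" and t: "0 < t" "t < 1" and q: "q < 1"
  shows "\<exists>X\<ge>X\<^sub>0. q * f X < f (t * X)"
proof (rule ccontr)
  assume "\<not> ?thesis"
  then have le: "f (t * X) \<le> q * f X" if "X \<ge> X\<^sub>0" for X using that by (auto simp: not_less)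
  have pos: "eventually (\<lambda>x. 0 < f x) at_top" using lim unfolding filterlim_at_top_dense by auto
  have "Limsup at_top (\<lambda>x. ereal (f (x * t) / f x)) \<le> ereal q"
  proof (rule Limsup_bounded)
    show "\<forall>\<^sub>F x in at_top. ereal (f (x * t) / f x) \<le> ereal q"
      using pos eventually_ge_at_top[of X\<^sub>0]
      by eventually_elim (use le in \<open>auto simp: field_simps\<close>)
  qed
  also have "\<dots> < 1" using q by simp
  finally show False using not mono t by (auto simp: positively_increasing_at_top_def)
qed

context stieltjes
begin

lemma gen_inverse_set:
  "{y. 0 < y \<and> ereal y < b \<and> X \<le> F y} \<noteq> {}" "bdd_below {y. 0 < y \<and> ereal y < b \<and> X \<le> F y}"
proof -
  obtain x where x: "x \<in> half_open b" "max X 0 < F x" using unbounded by blast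
  then have "x \<noteq> 0" using F0 by auto
  then show "{y. 0 < y \<and> ereal y < b \<and> X \<le> F y} \<noteq> {}"
    using x by (auto simp: half_open_def intro!: exI[of _ x])
  show "bdd_below {y. 0 < y \<and> ereal y < b \<and> X \<le> F y}" by (auto intro: bdd_belowI[of _ 0])
qed

lemma gen_inverse_mem: "gen_inverse b F X \<in> half_open b"
proof -
  obtain x where x: "0 < x" "ereal x < b" "X \<le> F x" using gen_inverse_set(1)[of X] by auto
  have "gen_inverse b F X \<le> x"
    unfolding gen_inverse_def using x by (intro cInf_lower gen_inverse_set) auto
  moreover have "0 \<le> gen_inverse b F X"
    unfolding gen_inverse_def by (rule cInf_greatest[OF gen_inverse_set(1)]) auto
  ultimately show ?thesis using x half_open_downward[of _ x b] by (auto simp: half_open_def)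
qed

lemma gen_inverse_lower: "u \<in> half_open b \<Longrightarrow> F u < X \<Longrightarrow> u \<le> gen_inverse b F X"
  unfolding gen_inverse_def
proof (rule cInf_greatest[OF gen_inverse_set(1)])
  fix y assume u: "u \<in> half_open b" "F u < X" and "y \<in> {y. 0 < y \<and> ereal y < b \<and> X \<le> F y}"
  then show "u \<le> y" using mono'[of y u] by (force simp: half_open_def)
qed

lemma gen_inverse_mono: "X \<le> Y \<Longrightarrow> gen_inverse b F X \<le> gen_inverse b F Y"
  unfolding gen_inverse_def by (rule cInf_superset_mono[OF gen_inverse_set]) auto

lemma le_F_above_gen_inverse:
  assumes "u \<in> half_open b" "gen_inverse b F X < u" shows "X \<le> F u"
proof -
  obtain y where "0 < y" "y < u" "X \<le> F y"
    using assms(2) cInf_lessD[OF gen_inverse_set(1)] unfolding gen_inverse_def by blast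
  then show ?thesis using mono'[of y u] assms by simp
qed

lemma F_gen_inverse_le:
  assumes X: "0 \<le> X"
  shows "F (gen_inverse b F X) \<le> X"
proof (cases "gen_inverse b F X = 0")
  case True
  then show ?thesis using X F0 by simp
next
  case False
  let ?r = "gen_inverse b F X"
  have r: "0 < ?r" "ereal ?r < b" using False gen_inverse_mem[of X] by (auto simp: half_open_def)
  have "(F \<longlongrightarrow> F ?r) (at_left ?r)" using left[OF r] by (simp add: continuous_within)
  moreover have "\<forall>\<^sub>F u in at_left ?r. F u \<le> X"
    using eventually_at_left_real[OF r(1)]
  proof eventually_elim
    case (elim u)
    have "\<not> X \<le> F u"
    proof
      assume "X \<le> F u"
      moreover have "ereal u < b" using elim r(2) less_trans[of "ereal u" "ereal ?r" b] by simp
      ultimately have "?r \<le> u"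
        unfolding gen_inverse_def using elim by (intro cInf_lower gen_inverse_set) auto
      then show False using elim by simp
    qed
    then show ?case by simp
  qed
  ultimately show ?thesis by (rule tendsto_upperbound) simp
qed

end

context string
begin

text \<open>
  With \<open>r\<close> the value of the generalized inverse at \<open>X\<close>, it can happen that \<open>R(r) < X\<close>.  Then \<open>R\<close> jumps at \<open>r\<close>,
  so that \<open>W\<close> is continuous there and a point slightly to the right of \<open>r\<close> serves instead.
\<close>

lemma right_approximation:
  assumes e: "0 < e"
  shows "\<exists>x\<in>half_open b. gen_inverse b R X \<le> x \<and> X \<le> R x \<and> W x \<le> W (gen_inverse b R X) + e"
proof (cases "X \<le> R (gen_inverse b R X)")
  case True
  then show ?thesis using R.gen_inverse_mem e by (intro bexI[of _ "gen_inverse b R X"]) auto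
next
  case False
  let ?r = "gen_inverse b R X"
  have "\<not> continuous (at ?r within half_open b) R"
  proof
    assume "continuous (at ?r within half_open b) R"
    then obtain u where "u > ?r" "u \<in> half_open b" "R u < R ?r + (X - R ?r)"
      using R.continuous_approx_right[OF R.gen_inverse_mem, of X "X - R ?r"] False by auto
    then show False using R.le_F_above_gen_inverse[of u X] by simp
  qed
  then have "continuous (at ?r within half_open b) W"
    using no_common_discontinuity[OF R.gen_inverse_mem] by blast
  from W.continuous_approx_right[OF R.gen_inverse_mem this e]
  obtain u where "u > ?r" "u \<in> half_open b" "W u < W ?r + e" by blast
  then show ?thesis using R.le_F_above_gen_inverse[of u X] by (intro bexI[of _ u]) auto
qed

abbreviation f where "f \<equiv> W \<circ> gen_inverse b R"

lemma f_mono: "mono_on {0<..} f"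
  by (intro mono_onI) (simp add: mono_onD[OF W.mono] R.gen_inverse_mem R.gen_inverse_mono)

lemma f_at_top: "filterlim f at_top at_top"
  unfolding filterlim_at_top
proof
  fix k :: real
  obtain x where x: "x \<in> half_open b" "k < W x" using W.unbounded by blast
  show "\<forall>\<^sub>F X in at_top. k \<le> f X"
    using eventually_gt_at_top[of "R x"]
  proof eventually_elim
    case (elim X)
    then have "x \<le> gen_inverse b R X" using R.gen_inverse_lower[OF x(1)] by simp
    then show ?case using W.mono'[of x "gen_inverse b R X"] R.gen_inverse_mem[of X] x
      by (auto simp: half_open_def)
  qed
qed

section \<open>Comparing the real and the imaginary part of the m-function\<close>

abbreviation m where "m y \<equiv> neumann_m b W R (\<i> * complex_of_real y)"

lemma m_upper: "0 < y \<Longrightarrow> x \<in> half_open b \<Longrightarrow> 4 < y * W x * cmod (m y) \<Longrightarrow> (cmod (m y))\<^sup>2 \<le> 4 * R x * Re (m y)"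
  using neumann_m_weyl_solution weyl_upper_bound by blast

lemma m_lower: "0 < y \<Longrightarrow> x \<in> half_open b \<Longrightarrow> 4 * y * W x * cmod (m y) \<le> 1 \<Longrightarrow> R x \<le> 4 * Re (m y)"
  using neumann_m_weyl_solution weyl_lower_bound by blast

lemma m_nonzero: "0 < y \<Longrightarrow> 0 < cmod (m y)"
proof (rule ccontr)
  assume y: "0 < y" and "\<not> 0 < cmod (m y)"
  then have "m y = 0" by simp
  moreover obtain x where "x \<in> half_open b" "0 < R x" using R.unbounded by blast
  ultimately show False using m_lower[OF y, of x] by simp
qed

lemma Re_m_pos: assumes y: "0 < y" shows "0 < Re (m y)"
proof -
  note L = m_nonzero[OF y]
  obtain x where x: "x \<in> half_open b" "4 / (y * cmod (m y)) < W x" using W.unbounded by blast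
  then have "(cmod (m y))\<^sup>2 \<le> 4 * R x * Re (m y)" using y L by (intro m_upper) (auto simp: field_simps)
  then have "0 < R x * Re (m y)" using zero_less_power[OF L, of 2] by linarith
  then show ?thesis using R.nonneg[OF x(1)] by (auto simp: zero_less_mult_iff)
qed

text \<open>
  Write \<open>L = \<bar>m\<bar>\<close>, \<open>f = W \<circ> R\<^sup>-\<^sup>1\<close> and \<open>X = max (8 L) X\<^sub>0\<close>.  The lower bound shows \<open>f(X) \<ge> 1 / (4 y L)\<close>.  By
  the growth assumption \<open>f(C X)\<close> is so large that the upper bound applies at the point \<open>R\<^sup>-\<^sup>1(C X)\<close>
  and gives \<open>L\<^sup>2 \<le> 4 C X Re m\<close>.  Since \<open>L\<close> is bounded below for \<open>y < 1\<close>, the quotient \<open>X / L\<close>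
  is bounded.  Any growth factor above \<open>16\<close> would do in place of \<open>200\<close>.
\<close>

lemma bounded_ratio_if_growth:
  assumes C: "0 < C" and X\<^sub>0: "0 < X\<^sub>0" and growth: "\<And>X. X \<ge> X\<^sub>0 \<Longrightarrow> 200 * f X \<le> f (C * X)"
  shows "\<exists>K. \<forall>y\<in>{0<..<1}. Im (m y) \<le> K * Re (m y)"
proof -
  obtain p where p: "p \<in> half_open b" "0 < W p" "0 < R p"
  proof -
    obtain u v where u: "u \<in> half_open b" "0 < W u" and v: "v \<in> half_open b" "0 < R v"
      using W.unbounded R.unbounded by blast
    have uv: "0 \<le> u" "0 \<le> v" using u v by (auto simp: half_open_def)
    show ?thesis
      using u v uv W.mono'[of u "max u v"] R.mono'[of v "max u v"]
      by (intro that[of "max u v"]) (auto simp: max_def split: if_splits)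
  qed
  define \<mu> where "\<mu> = min (1 / (4 * W p)) (R p / 4)"
  have \<mu>: "0 < \<mu>" using p by (simp add: \<mu>_def)
  have "Im (m y) \<le> 4 * C * max 8 (X\<^sub>0 / \<mu>) * Re (m y)" if y: "y \<in> {0<..<1}" for y
  proof -
    define L where "L = cmod (m y)"
    have y0: "0 < y" using y by simp
    have L: "0 < L" using m_nonzero[OF y0] by (simp add: L_def)
    have Re: "Re (m y) \<le> L" "0 < Re (m y)" using complex_Re_le_cmod Re_m_pos[OF y0] by (auto simp: L_def)
    have "\<mu> \<le> L"
    proof (cases "4 * y * W p * L \<le> 1")
      case True
      then have "R p \<le> 4 * Re (m y)" using m_lower[OF y0 p(1)] by (simp add: L_def)
      then show ?thesis using Re by (simp add: \<mu>_def)
    next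
      case False
      have "y * (W p * L) \<le> 1 * (W p * L)" using y p L by (intro mult_right_mono) auto
      then have "1 / (4 * W p) \<le> L" using False p by (simp add: field_simps)
      then show ?thesis by (simp add: \<mu>_def)
    qed
    define X where "X = max (8 * L) X\<^sub>0"
    have X: "8 * L \<le> X" "X\<^sub>0 \<le> X" by (auto simp: X_def)
    have "1 / (4 * y * L) \<le> f X"
    proof (rule field_le_epsilon)
      fix e :: real assume "0 < e"
      then obtain x where x: "x \<in> half_open b" "X \<le> R x" "W x \<le> f X + e"
        using right_approximation[of e X] by auto
      have "\<not> 4 * y * W x * L \<le> 1"
      proof
        assume "4 * y * W x * L \<le> 1"
        then have "R x \<le> 4 * Re (m y)" using m_lower[OF y0 x(1)] by (simp add: L_def)
        then show False using x X Re L by linarith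
      qed
      then have "1 / (4 * y * L) \<le> W x" using y L by (simp add: field_simps)
      then show "1 / (4 * y * L) \<le> f X + e" using x by linarith
    qed
    then have "200 * (1 / (4 * y * L)) \<le> f (C * X)" using growth[OF X(2)] by linarith
    then have "4 < y * W (gen_inverse b R (C * X)) * L" using y L by (simp add: field_simps)
    then have "L\<^sup>2 \<le> 4 * R (gen_inverse b R (C * X)) * Re (m y)"
      using m_upper[OF y0 R.gen_inverse_mem] by (simp add: L_def)
    also have "\<dots> \<le> 4 * (C * X) * Re (m y)"
      using R.F_gen_inverse_le[of "C * X"] C X X\<^sub>0 Re by (intro mult_right_mono mult_left_mono) auto
    finally have "L \<le> 4 * C * (X / L) * Re (m y)" using L by (simp add: field_simps power2_eq_square)
    also have "\<dots> \<le> 4 * C * max 8 (X\<^sub>0 / \<mu>) * Re (m y)"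
    proof -
      define k where "k = max 8 (X\<^sub>0 / \<mu>)"
      have "X\<^sub>0 / L \<le> X\<^sub>0 / \<mu>" using \<open>\<mu> \<le> L\<close> \<mu> X\<^sub>0 by (intro divide_left_mono) auto
      then have "X\<^sub>0 / L \<le> k" "8 \<le> k" by (auto simp: k_def)
      then have "X\<^sub>0 \<le> k * L" "8 * L \<le> k * L" using L by (auto simp: field_simps)
      then have "X / L \<le> max 8 (X\<^sub>0 / \<mu>)" using L by (simp add: X_def k_def[symmetric] field_simps)
      then show ?thesis using C Re by (intro mult_right_mono mult_left_mono) auto
    qed
    finally show ?thesis using abs_Im_le_cmod[of "m y"] by (simp add: L_def)
  qed
  then show ?thesis by blast
qed

text \<open>
  Suppose that \<open>f = W \<circ> R\<^sup>-\<^sup>1\<close> is not positively increasing.  Then there are arbitrarily large \<open>X\<close>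
  such that \<open>W\<close> is nearly constant, with value about \<open>w\<close>, while \<open>R\<close> grows from \<open>t X\<close> to \<open>X\<close>, say on
  \<open>[x\<^sub>1, x\<^sub>2)\<close>.  The frequency \<open>y\<close> is placed in the geometric middle of this window, \<open>1 / (y w) = \<surd>t X = S\<close>.  The two
  general bounds give that \<open>\<bar>m\<bar>\<close> is comparable to \<open>S\<close>.  On the window \<open>u\<^sub>2\<close> is nearly constant, and its
  energy there is at most \<open>Re m\<close>, which is small against the growth of \<open>R\<close>; hence \<open>\<bar>u\<^sub>2(x\<^sub>1)\<bar>\<close> is small.  By the energy
  identity at \<open>x\<^sub>1\<close>, \<open>Re m\<close> is at most the energy of \<open>u\<^sub>2\<close> on \<open>[0, x\<^sub>1)\<close> plus \<open>\<bar>u\<^sub>1(x\<^sub>1)\<bar> \<bar>u\<^sub>2(x\<^sub>1)\<bar>\<close>, and both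
  are small multiples of \<open>\<bar>m\<bar>\<close>.
\<close>

lemma positively_increasing_if_bounded_ratio:
  assumes K: "0 \<le> K" "\<And>y. 0 < y \<Longrightarrow> y < 1 \<Longrightarrow> Im (m y) \<le> K * Re (m y)"
  shows "positively_increasing_at_top f"
proof (rule ccontr)
  assume not: "\<not> positively_increasing_at_top f"
  have flat: "\<exists>X\<ge>X\<^sub>0. q * f X < f (t * X)" if "0 < t" "t < 1" "q < 1" for t q X\<^sub>0
    by (rule not_positively_increasing_imp_flat[OF f_mono f_at_top not that])
  \<comment> \<open>The final estimate is \<open>Re m \<le> 13 \<sigma> \<bar>m\<bar>\<close>, while the assumption gives \<open>\<bar>m\<bar> \<le> (1 + K) Re m\<close>;
    the exponents in \<open>t = \<sigma>\<^sup>4\<close> and \<open>\<tau> = \<surd>t = \<sigma>\<^sup>2\<close> avoid square roots.\<close>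
  define \<sigma> where "\<sigma> = 1 / (100 * (1 + K))"
  define \<tau> where "\<tau> = \<sigma>\<^sup>2"
  define t where "t = \<tau>\<^sup>2"
  have \<sigma>: "0 < \<sigma>" "\<sigma> \<le> 1 / 100" using K(1) by (auto simp: \<sigma>_def field_simps)
  have \<tau>: "0 < \<tau>" "\<tau> \<le> \<sigma> / 100" "\<tau> \<le> 1 / 100"
  proof -
    show "\<tau> \<le> \<sigma> / 100" using mult_left_mono[OF \<sigma>(2), of \<sigma>] \<sigma> by (simp add: \<tau>_def power2_eq_square)
    then show "0 < \<tau>" "\<tau> \<le> 1 / 100" using \<sigma> by (auto simp: \<tau>_def)
  qed
  have t: "0 < t" "t \<le> 1 / 100"
    using \<tau> mult_mono[of \<tau> "1/100" \<tau> 1] by (auto simp: t_def power2_eq_square)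
  obtain Y where Y: "\<And>X. X \<ge> Y \<Longrightarrow> 1 \<le> f X"
    using f_at_top unfolding filterlim_at_top eventually_at_top_linorder by blast
  have "\<exists>X\<ge>max (Y / t) (2 / \<tau>). 1 / (1 + \<tau>) * f X < f (t * X)"
    using t \<tau> by (intro flat) auto
  then obtain X where X: "Y / t \<le> X" "2 / \<tau> \<le> X" "1 / (1 + \<tau>) * f X < f (t * X)" by auto
  define w where "w = f (t * X)"
  define S where "S = \<tau> * X"
  define y where "y = 1 / (w * S)"
  have w: "1 \<le> w" unfolding w_def using X(1) t by (intro Y) (simp add: field_simps)
  have S: "2 \<le> S" using X(2) \<tau> by (simp add: S_def field_simps)
  have X0: "0 < X" using S \<tau> unfolding S_def by (smt (verit) zero_less_mult_pos)
  have wS: "2 \<le> w * S" using mult_mono[OF w S] S w by simp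
  have y: "0 < y" "y < 1" and ywS: "y * w * S = 1" using wS w S by (auto simp: y_def)
  have fX: "f X < (1 + \<tau>) * w" using X(3) \<tau> by (simp add: w_def field_simps)
  define x\<^sub>1 where "x\<^sub>1 = gen_inverse b R (t * X)"
  have x1: "x\<^sub>1 \<in> half_open b" "W x\<^sub>1 = w" "R x\<^sub>1 \<le> t * X" "0 \<le> x\<^sub>1"
    using R.gen_inverse_mem[of "t * X"] R.F_gen_inverse_le[of "t * X"] t X0
    by (auto simp: x\<^sub>1_def w_def half_open_def)
  obtain x\<^sub>2 where x2: "x\<^sub>2 \<in> half_open b" "gen_inverse b R X \<le> x\<^sub>2" "X \<le> R x\<^sub>2" "W x\<^sub>2 \<le> f X + \<tau> * w"
    using right_approximation[of "\<tau> * w" X] \<tau> w by auto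
  have "t * X \<le> 1 * X" using t X0 by (intro mult_right_mono) auto
  then have x12: "x\<^sub>1 \<le> x\<^sub>2" using R.gen_inverse_mono[of "t * X" X] x2(2) by (simp add: x\<^sub>1_def)
  have W2: "W x\<^sub>2 - w \<le> 2 * \<tau> * w" using x2(4) fX by (simp add: algebra_simps)
  then have W2': "W x\<^sub>2 \<le> 2 * w" using mult_right_mono[OF \<tau>(3), of w] w by linarith
  obtain u\<^sub>1 u\<^sub>2 where weyl: "\<And>x. x \<in> half_open b \<Longrightarrow> weyl_solution y x (m y) u\<^sub>1 u\<^sub>2"
    using neumann_m_weyl_solution[OF y(1)] by blast
  have u: "string_solution b W R (\<i> * of_real y) u\<^sub>1 u\<^sub>2" "u\<^sub>1 0 = - m y" "u\<^sub>2 0 = 1"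
    using weyl[OF W.zero_mem] by (auto simp: weyl_solution_def)
  have z: "\<i> * of_real y \<noteq> 0" using y by simp
  define L where "L = cmod (m y)"
  have L: "0 < L" using m_nonzero[OF y(1)] by (simp add: L_def)
  have Re: "Re (m y) \<le> L" "0 < Re (m y)" using complex_Re_le_cmod Re_m_pos[OF y(1)] by (auto simp: L_def)
  have Im: "Im (m y) \<le> L" using abs_Im_le_cmod[of "m y"] by (simp add: L_def)
  have I2: "(LINT s:{0..<x}|R.M. (cmod (u\<^sub>2 s))\<^sup>2) \<le> Re (m y)"
    and I1: "y * (LINT s:{0..<x}|W.M. (cmod (u\<^sub>1 s))\<^sup>2) \<le> L" if "x \<in> half_open b" for x
    using weyl[OF that] Im by (auto simp: weyl_solution_def)
  have tX: "t * X = \<tau> * S" by (simp add: t_def S_def power2_eq_square)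
  have L_le: "L \<le> 4 * S"
  proof (cases "4 < y * W x\<^sub>1 * L")
    case True
    have "L\<^sup>2 \<le> 4 * R x\<^sub>1 * Re (m y)" using m_upper[OF y(1) x1(1)] True by (simp add: L_def)
    also have "\<dots> \<le> 4 * (\<tau> * S) * L"
      using x1(3) Re L \<tau> S R.nonneg[OF x1(1)] unfolding tX by (intro mult_mono) auto
    finally have "L \<le> 4 * (\<tau> * S)" using L by (simp add: power2_eq_square)
    also have "\<dots> \<le> 4 * (1 * S)" using \<tau> S by (intro mult_left_mono mult_right_mono) auto
    finally show ?thesis by simp
  next
    case False
    then have "y * w * L \<le> 4 * (y * w * S)" using x1(2) ywS by simp
    then have "(y * w) * L \<le> (y * w) * (4 * S)" by (simp add: algebra_simps)
    then show ?thesis using y w by simp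
  qed
  have L_ge: "S \<le> 8 * L"
  proof (cases "4 * y * W x\<^sub>2 * L \<le> 1")
    case True
    have "X \<le> 4 * Re (m y)" using m_lower[OF y(1) x2(1)] True x2(3) by (simp add: L_def)
    moreover have "S \<le> 1 * X" unfolding S_def using \<tau> X0 by (intro mult_right_mono) auto
    ultimately show ?thesis using Re by linarith
  next
    case False
    have "y * w * S < 4 * y * W x\<^sub>2 * L" using False ywS by simp
    also have "\<dots> \<le> 4 * y * (2 * w) * L" using W2' y L by (intro mult_right_mono mult_left_mono) auto
    finally have "(y * w) * S < (y * w) * (8 * L)" by (simp add: algebra_simps)
    then show ?thesis using y w by simp
  qed
  have incr: "cmod (u\<^sub>2 s - u\<^sub>2 x\<^sub>1) \<le> 3 * \<sigma>" if s: "s \<in> {x\<^sub>1..<x\<^sub>2}" for s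
  proof -
    have sD: "s \<in> half_open b" using s x1(4) by (intro half_open_Icc[OF _ x2(1)]) auto
    have nn: "0 \<le> y * (LINT s:{0..<s}|W.M. (cmod (u\<^sub>1 s))\<^sup>2)"
      using y by (intro mult_nonneg_nonneg set_lint_nonneg) auto
    have "(cmod (u\<^sub>2 s - u\<^sub>2 x\<^sub>1))\<^sup>2 \<le> (y * (W s - W x\<^sub>1)) * (y * (LINT s:{0..<s}|W.M. (cmod (u\<^sub>1 s))\<^sup>2))"
      using solution_increments(2)[OF u(1) y(1) x1(4) _ sD] s by (simp add: power2_eq_square mult_ac)
    also have "\<dots> \<le> (y * (2 * \<tau> * w)) * (4 * S)"
    proof (rule mult_mono)
      have "W s \<le> W x\<^sub>2" using s x1(4) x2(1) by (intro W.mono') auto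
      then have "W s - W x\<^sub>1 \<le> 2 * \<tau> * w" using W2 x1(2) by simp
      then show "y * (W s - W x\<^sub>1) \<le> y * (2 * \<tau> * w)" using y by (intro mult_left_mono) auto
      show "0 \<le> y * (2 * \<tau> * w)" using y \<tau> w by simp
    qed (use I1[OF sD] L_le nn in auto)
    also have "\<dots> = 8 * \<tau> * (y * w * S)" by (simp add: algebra_simps)
    also have "\<dots> \<le> (3 * \<sigma>)\<^sup>2" using \<tau> unfolding ywS by (simp add: \<tau>_def power2_eq_square)
    finally show ?thesis by (rule power2_le_imp_le) (use \<sigma> in simp)
  qed
  have \<beta>: "cmod (u\<^sub>2 x\<^sub>1) \<le> 6 * \<sigma>"
  proof (rule ccontr)
    assume "\<not> cmod (u\<^sub>2 x\<^sub>1) \<le> 6 * \<sigma>"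
    then have large: "3 * \<sigma> \<le> cmod (u\<^sub>2 s)" if "s \<in> {x\<^sub>1..<x\<^sub>2}" for s
      using incr[OF that] norm_triangle_ineq4[of "u\<^sub>2 s" "u\<^sub>2 s - u\<^sub>2 x\<^sub>1"] by simp
    note e = energy_identity(2)[OF u(1) z x2(1)]
    have "(99 / 100 * X) * (9 * \<tau>) \<le> (R x\<^sub>2 - R x\<^sub>1) * (3 * \<sigma>)\<^sup>2"
    proof (intro mult_mono)
      have "t * X \<le> 1 / 100 * X" using t X0 by (intro mult_right_mono) auto
      then show "99 / 100 * X \<le> R x\<^sub>2 - R x\<^sub>1" using x1(3) x2(3) by simp
      then show "0 \<le> R x\<^sub>2 - R x\<^sub>1" using X0 by simp
    qed (use \<tau> in \<open>auto simp: \<tau>_def power_mult_distrib\<close>)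
    also have "\<dots> = (LINT s:{x\<^sub>1..<x\<^sub>2}|R.M. (3 * \<sigma>)\<^sup>2)"
      by (subst R.set_lint_const) (use x1 x12 x2 in auto)
    also have "\<dots> \<le> (LINT s:{x\<^sub>1..<x\<^sub>2}|R.M. (cmod (u\<^sub>2 s))\<^sup>2)"
    proof (intro set_integral_mono R.set_integrable_const x1 x2 power_mono large)
      show "set_integrable R.M {x\<^sub>1..<x\<^sub>2} (\<lambda>s. (cmod (u\<^sub>2 s))\<^sup>2)"
        using x1 x2 by (intro set_integrable_subset[OF e]) auto
    qed (use \<sigma> in auto)
    also have "\<dots> \<le> (LINT s:{0..<x\<^sub>2}|R.M. (cmod (u\<^sub>2 s))\<^sup>2)"
      by (intro R.set_lint_mono_interval x1 x12 x2 e) auto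
    also have "\<dots> \<le> 4 * (\<tau> * X)" using I2[OF x2(1)] Re L_le by (simp add: S_def)
    finally show False using \<tau> X0 by (simp add: algebra_simps)
  qed
  define A where "A = (LINT s:{0..<x\<^sub>1}|R.M. (cmod (u\<^sub>2 s))\<^sup>2)"
  have "A \<le> (LINT s:{0..<x\<^sub>1}|R.M. 3\<^sup>2)"
    unfolding A_def
  proof (intro set_integral_mono R.set_integrable_const x1 energy_identity(2)[OF u(1) z] power_mono)
    fix s assume s: "s \<in> {0..<x\<^sub>1}"
    have sD: "s \<in> half_open b" using s by (intro half_open_Icc[OF _ x1(1)]) auto
    have nn: "0 \<le> y * (LINT s:{0..<s}|W.M. (cmod (u\<^sub>1 s))\<^sup>2)"
      using y by (intro mult_nonneg_nonneg set_lint_nonneg) auto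
    have "(cmod (u\<^sub>2 s - 1))\<^sup>2 \<le> (y * W s) * (y * (LINT s:{0..<s}|W.M. (cmod (u\<^sub>1 s))\<^sup>2))"
      using solution_increments(2)[OF u(1) y(1) _ _ sD, of 0] s u(3) W.F0
      by (simp add: power2_eq_square mult_ac)
    also have "\<dots> \<le> (y * w) * (4 * S)"
    proof (rule mult_mono)
      have "W s \<le> w" using s x1 W.mono'[of s x\<^sub>1] by auto
      then show "y * W s \<le> y * w" using y by (intro mult_left_mono) auto
      show "0 \<le> y * w" using y w by simp
    qed (use I1[OF sD] L_le nn in auto)
    also have "\<dots> = 2\<^sup>2" using ywS by simp
    finally have "cmod (u\<^sub>2 s - 1) \<le> 2" by (rule power2_le_imp_le) simp
    then show "cmod (u\<^sub>2 s) \<le> 3" using norm_triangle_ineq[of "u\<^sub>2 s - 1" 1] by simp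
  qed auto
  also have "\<dots> = R x\<^sub>1 * 9" using x1 by (subst R.set_lint_const) (auto simp: R.F0)
  also have "\<dots> \<le> \<tau> * S * 9" using x1(3) unfolding tX by simp
  also have "\<dots> \<le> \<tau> * (8 * L) * 9" using \<tau> L_ge by (intro mult_right_mono mult_left_mono) auto
  finally have A: "A \<le> 72 * \<tau> * L" by simp
  have u1: "cmod (u\<^sub>1 x\<^sub>1) \<le> 2 * L"
  proof -
    have "(cmod (u\<^sub>1 x\<^sub>1 + m y))\<^sup>2 \<le> R x\<^sub>1 * A"
      using solution_increments(1)[OF u(1) y(1) _ x1(4,1)] u(2) by (simp add: R.F0 A_def)
    also have "\<dots> \<le> (\<tau> * S) * L"
      using x1(3) I2[OF x1(1)] Re R.nonneg[OF x1(1)] set_lint_nonneg[of "{0..<x\<^sub>1}" "\<lambda>s. (cmod (u\<^sub>2 s))\<^sup>2"] \<tau> S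
      unfolding tX A_def by (intro mult_mono) auto
    also have "\<dots> \<le> (1 / 100 * (8 * L)) * L" using \<tau> L_ge L S by (intro mult_right_mono mult_mono) auto
    also have "\<dots> \<le> L\<^sup>2" using L by (simp add: power2_eq_square)
    finally have "cmod (u\<^sub>1 x\<^sub>1 + m y) \<le> L" by (rule power2_le_imp_le) (use L in simp)
    then show ?thesis using norm_triangle_ineq4[of "u\<^sub>1 x\<^sub>1 + m y" "m y"] by (simp add: L_def)
  qed
  have "Re (cnj (u\<^sub>1 x\<^sub>1) * u\<^sub>2 x\<^sub>1) = - Re (m y) + A"
    unfolding energy_identity(3)[OF u(1) z x1(1)] by (simp add: u A_def)
  moreover have "- Re (cnj (u\<^sub>1 x\<^sub>1) * u\<^sub>2 x\<^sub>1) \<le> cmod (u\<^sub>1 x\<^sub>1) * cmod (u\<^sub>2 x\<^sub>1)"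
    using abs_Re_le_cmod[of "cnj (u\<^sub>1 x\<^sub>1) * u\<^sub>2 x\<^sub>1"] by (simp add: norm_mult)
  moreover have "cmod (u\<^sub>1 x\<^sub>1) * cmod (u\<^sub>2 x\<^sub>1) \<le> (2 * L) * (6 * \<sigma>)"
    using u1 \<beta> L by (intro mult_mono) auto
  moreover have "\<tau> * L \<le> \<sigma> / 100 * L" using \<tau>(2) L by (intro mult_right_mono) auto
  ultimately have "Re (m y) \<le> 13 * \<sigma> * L" using A mult_pos_pos[OF \<sigma>(1) L] by (simp add: algebra_simps)
  then have "(1 + K) * Re (m y) \<le> (1 + K) * (13 * \<sigma> * L)" using K by (intro mult_left_mono) auto
  also have "\<dots> = 13 / 100 * L" using K(1) by (simp add: \<sigma>_def field_simps)
  finally have "(1 + K) * Re (m y) \<le> 13 / 100 * L" .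
  moreover have "L \<le> (1 + K) * Re (m y)"
  proof -
    have "L \<le> \<bar>Re (m y)\<bar> + \<bar>Im (m y)\<bar>" unfolding L_def by (rule cmod_le)
    moreover have "0 \<le> Im (m y)"
      using weyl[OF W.zero_mem] by (simp add: weyl_solution_def set_lebesgue_integral_def)
    ultimately show ?thesis using K(2)[OF y] Re by (simp add: algebra_simps)
  qed
  ultimately show False using L by linarith
qed

end

theorem corollary2p15:
  fixes b :: ereal and W R :: "real \<Rightarrow> real"
  assumes "0 < b"
    and "W \<in> half_open b \<rightarrow> {0..}" and "R \<in> half_open b \<rightarrow> {0..}"
    and "\<And>x. 0 < x \<Longrightarrow> ereal x < b \<Longrightarrow> continuous (at_left x) W"
    and "\<And>x. 0 < x \<Longrightarrow> ereal x < b \<Longrightarrow> continuous (at_left x) R"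
    and "mono_on (half_open b) W" and "mono_on (half_open b) R"
    and "\<not> bdd_above (W ` half_open b)" and "\<not> bdd_above (R ` half_open b)"
    and "W 0 = 0" and "R 0 = 0"
    and "\<And>x. x \<in> half_open b \<Longrightarrow>
           continuous (at x within half_open b) W \<or> continuous (at x within half_open b) R"
  shows "(SUP y\<in>{0<..<1::real}.
            ereal (Im (neumann_m b W R (\<i> * of_real y)) / Re (neumann_m b W R (\<i> * of_real y)))) < \<infinity>
         \<longleftrightarrow> positively_increasing_at_top (W \<circ> gen_inverse b R)"
    (is "?S < \<infinity> \<longleftrightarrow> _")
proof -
  have "stieltjes b W" by (rule stieltjes.intro) (fact assms)+
  moreover have "stieltjes b R" by (rule stieltjes.intro) (fact assms)+
  moreover have "string_axioms b W R" by (rule string_axioms.intro) (fact assms)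
  ultimately interpret string b W R by (rule string.intro)
  show ?thesis
  proof
    assume "?S < \<infinity>"
    then obtain n :: nat where n: "?S < ereal (real n)" using less_PInf_Ex_of_nat[of ?S] by auto
    have ratio: "Im (m y) \<le> real n * Re (m y)" if y: "0 < y" "y < 1" for y
    proof -
      have "ereal (Im (m y) / Re (m y)) \<le> ?S" using y by (intro SUP_upper) auto
      then have "ereal (Im (m y) / Re (m y)) \<le> ereal (real n)" using n by (meson less_imp_le order_trans)
      then have "Im (m y) / Re (m y) \<le> real n" by simp
      then show ?thesis using Re_m_pos[OF y(1)] by (simp add: field_simps)
    qed
    show "positively_increasing_at_top f"
      by (rule positively_increasing_if_bounded_ratio[OF of_nat_0_le_iff ratio])
  next
    assume "positively_increasing_at_top f"
    from positively_increasing_imp_growth[OF this f_at_top, of 200]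
    obtain C X\<^sub>0 where "0 < C" "0 < X\<^sub>0" "\<And>X. X \<ge> X\<^sub>0 \<Longrightarrow> 200 * f X \<le> f (C * X)" by auto
    from bounded_ratio_if_growth[OF this]
    obtain K where K: "\<And>y. y \<in> {0<..<1} \<Longrightarrow> Im (m y) \<le> K * Re (m y)" by blast
    have "?S \<le> ereal K"
    proof (rule SUP_least)
      fix y :: real assume y: "y \<in> {0<..<1}"
      then show "ereal (Im (m y) / Re (m y)) \<le> ereal K"
        using K[OF y] Re_m_pos[of y] by (simp add: field_simps)
    qed
    then show "?S < \<infinity>" by (rule le_less_trans) simp
  qed
qed

end
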